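(* Consider the parametric optimal control problem described in the context, with data $d$ and local primal-dual solution $w^\star$, and let $\mathcal{LQP}$ be the associated linear-quadratic problem with an arbitrary perturbation direction $l=(l_{-1},l_0,\dots,l_N)$. Suppose there is a constant $\gamma_H>0$ (independent of $N$) such that the reduced Hessian at $(w^\star;d)$ satisfies $ReH(w^\star;d)\succeq\gamma_HI$. Let $(p^\star,q^\star)$ be the primal solution of $\mathcal{LQP}$. Then the dual solution $\zeta^\star$ of $\mathcal{LQP}$ at each stage is $$\zeta_k^\star=-2K_{k+1}p^\star_{k+1}+2\sum_{i=k+1}^{N}(M_i^{k+1})^Tl_i+2\sum_{i=k+1}^{N-1}(V_i^{k+1})^TC_il_i,\qquad k\in\{-1,0,\dots,N-1\},$$ where $K_N=Q_N$, $D_{N1}=D_N$, $D_{N2}=0$, and for $k\in\{0,\dots,N-1\}$, $$W_k=R_k+B_k^TK_{k+1}B_k,$$ $$K_k=Q_k+A_k^TK_{k+1}A_k-(B_k^TK_{k+1}A_k+S_k)^TW_k^{-1}(B_k^TK_{k+1}A_k+S_k),$$ $$P_k=-W_k^{-1}(B_k^TK_{k+1}A_k+S_k),\qquad E_k=A_k+B_kP_k,$$ $$V_i^k=-K_{i+1}\prod_{j=k}^{i}E_j\ \ (i\in\{0,\dots,N-1\}),\qquad M_i^k=-(D_{i1}+D_{i2}P_i)\prod_{j=k}^{i-1}E_j\ \ (i\in\{0,\dots,N\}).$$ The same formula holds for the dual solution $\zeta^{c\star}$ of the convexified problem $\mathcal{CLQP}$ (obtained with $\beta\in(0,\gamma_H)$),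 with $p^\star$ the primal solution of $\mathcal{CLQP}$ and with $\{H_k,D_k\}$ (that is, the blocks $Q_k,S_k,R_k,D_{k1},D_{k2}$ for $k\in\{0,\dots,N-1\}$ and $Q_N,D_N$) replaced by $\{\tilde H_k,\tilde D_k\}$ (that is, $\tilde Q_k,\tilde S_k,\tilde R_k,\tilde D_{k1},\tilde D_{k2}$ and $\tilde Q_N,\tilde D_N$) in the formulas defining $K_N$, $D_{N1}$, $W_k$, $K_k$, $P_k$, $E_k$, $V_i^k$ and $M_i^k$.
   Context: **Conventions.** $[n]=\{0,\dots,n\}$. For matrices, $\prod_{j=m}^nE_j=E_nE_{n-1}\cdots E_m$ if $m\le n$ and $I$ otherwise. For $i=N$ the term $D_{N2}P_N$ is read as $0$, so $M_N^k=-D_N\prod_{j=k}^{N-1}E_j$ (also with $M_N^N=-D_N$). Sums over empty ranges are $0$. **Parametric optimal control problem.** Let $N\ge 1$. Given data $d=(d_{-1},d_0,\dots,d_N)$ with $d_{-1}=\bar x_0\in\mathbb{R}^{n_x}$ and $d_k\in\mathbb{R}^{n_d}$ for $k\in[N]$, consider $$\min_{\{x_k\},\{u_k\}}\ \sum_{k=0}^{N-1}g_k(x_k,u_k;d_k)+g_N(x_N;d_N)\quad\text{s.t. } x_{k+1}=f_k(x_k,u_k;d_k)\ (\lambda_k),\ k\in[N-1],\quad x_0=\bar x_0\ (\lambda_{-1}),$$ with $x_k\in\mathbb{R}^{n_x}$, $u_k\in\mathbb{R}^{n_u}$, multipliers $\lambda_k\in\mathbb{R}^{n_x}$, and $f_k,g_k$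 twice continuously differentiable. Write $z_k=(x_k;u_k)$, $z_N=x_N$, $w=(x,u,\lambda)$. The Lagrangian is $\sum_{k=0}^{N}\mathcal L_k-\lambda_{-1}^Td_{-1}$ with $\mathcal L_k=g_k(z_k;d_k)+\lambda_{k-1}^Tx_k-\lambda_k^Tf_k(z_k;d_k)$ for $k\in[N-1]$ and $\mathcal L_N=g_N(x_N;d_N)+\lambda_{N-1}^Tx_N$. Let $w^\star$ be a local minimizer with its multipliers (local primal-dual solution). **Matrices** (all evaluated at $(w^\star;d)$). For $k\in[N-1]$: $A_k=\partial f_k/\partial x_k$, $B_k=\partial f_k/\partial u_k$, $C_k=\partial f_k/\partial d_k$ (Jacobians); $H_k=\begin{pmatrix} Q_k & S_k^T \\ S_k & R_k \end{pmatrix}=\nabla^2_{z_k}\mathcal L_k$ (blocks $Q_k=\nabla^2_{x_k}\mathcal L_k$, $S_k=\nabla^2_{u_kx_k}\mathcal L_k$, $R_k=\nabla^2_{u_k}\mathcal L_k$); $D_k=(D_{k1}\ D_{k2})=(\nabla^2_{d_kx_k}\mathcal L_k\ \ \nabla^2_{d_ku_k}\mathcal L_k)$. Also $H_N=Q_N=\nabla^2_{x_N}\mathcal L_N$, $D_N=\nabla^2_{d_Nx_N}\mathcal L_N$. **Reduced Hessian.** $H=\mathrm{diag}(H_0,\dots,H_N)$; $G$ is the Jacobian of the constraints with respect to $z=(z_0;\dots;z_N)$: its first block row is $z\mapsto x_0$, and the block row for stage $k\in[N-1]$ is $z\mapsto x_{k+1}-A_kx_k-B_ku_k$. $Z$ is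 a matrix whose columns form an orthonormal basis of $\ker G$; $ReH=Z^THZ$. (It is known that $ReH\succ0$ implies each $W_k$ is invertible.) **Problem $\mathcal{LQP}$.** For a direction $l=(l_{-1},l_0,\dots,l_N)$: $$\min_{\{p_k\},\{q_k\}}\ \sum_{k=0}^{N-1}\begin{pmatrix} p_k \\ q_k \\ l_k \end{pmatrix}^T\begin{pmatrix} Q_k & S_k^T & D_{k1}^T \\ S_k & R_k & D_{k2}^T \\ D_{k1} & D_{k2} & 0 \end{pmatrix}\begin{pmatrix} p_k \\ q_k \\ l_k \end{pmatrix}+\begin{pmatrix} p_N \\ l_N \end{pmatrix}^T\begin{pmatrix} Q_N & D_N^T \\ D_N & 0 \end{pmatrix}\begin{pmatrix} p_N \\ l_N \end{pmatrix}$$ $$\text{s.t. } p_{k+1}=A_kp_k+B_kq_k+C_kl_k\ (\zeta_k),\ k\in[N-1],\qquad p_0=l_{-1}\ (\zeta_{-1}).$$ Sign convention for multipliers: the Lagrangian is (objective) $+\sum_{k=0}^{N-1}\zeta_k^T(p_{k+1}-A_kp_k-B_kq_k-C_kl_k)+\zeta_{-1}^T(p_0-l_{-1})$. When $ReH\succ0$, $\mathcal{LQP}$ has a unique (global) primal-dual solution. **Convexification procedure** with parameter $\beta>0$. Set $\tilde H_N=\tilde Q_N=\beta I$, $\bar Q_N=Q_N-\tilde Q_N$, $\tilde D_N=D_N$. For $k=N-1,\dots,0$: set $$\begin{pmatrix} \hat Q_k & \tilde S_k^T & \tilde D_{k1}^T \\ \tilde S_k & \tilde R_k & \tilde D_{k2}^T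 \\ \tilde D_{k1} & \tilde D_{k2} & * \end{pmatrix}=\begin{pmatrix} Q_k & S_k^T & D_{k1}^T \\ S_k & R_k & D_{k2}^T \\ D_{k1} & D_{k2} & 0 \end{pmatrix}+\begin{pmatrix} A_k^T \\ B_k^T \\ C_k^T \end{pmatrix}\bar Q_{k+1}\begin{pmatrix} A_k & B_k & C_k \end{pmatrix}$$ (the block $*$ is discarded), $\tilde Q_k=\tilde S_k^T\tilde R_k^{-1}\tilde S_k+\beta I$, $\tilde H_k=\begin{pmatrix} \tilde Q_k & \tilde S_k^T \\ \tilde S_k & \tilde R_k \end{pmatrix}$, $\tilde D_k=(\tilde D_{k1}\ \tilde D_{k2})$, $\bar Q_k=\hat Q_k-\tilde Q_k$. (When $ReH\succeq\gamma_HI$ and $\beta\in(0,\gamma_H)$, it is known that all $\tilde H_k\succ0$, so the procedure is well defined.) **Problem $\mathcal{CLQP}$** is $\mathcal{LQP}$ with $\{H_k,D_k\}$ replaced by $\{\tilde H_k,\tilde D_k\}$ (constraints, $l$ and sign convention unchanged). *)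

theory Defs
  imports "HOL-Analysis.Analysis"
begin

text \<open>
  Conventions. A stage-indexed sequence is a function on \<open>nat\<close>; only stages up to the horizon
  \<open>N\<close> matter. The data \<open>d\<^sub>-\<^sub>1\<close> and the direction \<open>l\<^sub>-\<^sub>1\<close>, which live in the state space, are kept as
  separate arguments. Multiplier sequences are shifted by one: \<open>lam j\<close> is the multiplier of the
  equation that determines the state at stage \<open>j\<close>, so \<open>lam 0\<close> belongs to the initial condition
  (\<open>\<lambda>\<^sub>-\<^sub>1\<close>) and \<open>lam (Suc k)\<close> to the dynamics of stage \<open>k\<close> (\<open>\<lambda>\<^sub>k\<close>). Likewise for \<open>\<zeta>\<close>.
\<close>

definition twice_continuously_differentiable ::
  "('a::real_normed_vector \<Rightarrow> 'b::real_normed_vector) \<Rightarrow> bool" where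
  "twice_continuously_differentiable F \<longleftrightarrow>
    (\<exists>(F' :: 'a \<Rightarrow> 'a \<Rightarrow>\<^sub>L 'b) (F'' :: 'a \<Rightarrow> 'a \<Rightarrow>\<^sub>L 'a \<Rightarrow>\<^sub>L 'b).
      (\<forall>x. (F has_derivative blinfun_apply (F' x)) (at x)) \<and>
      (\<forall>x. (F' has_derivative blinfun_apply (F'' x)) (at x)) \<and>
      continuous_on UNIV F'')"

definition gradient :: "(real^'n \<Rightarrow> real) \<Rightarrow> real^'n \<Rightarrow> real^'n" where
  "gradient \<phi> v = (\<chi> i. frechet_derivative \<phi> (at v) (axis i 1))"

definition hessian :: "(real^'n \<Rightarrow> real) \<Rightarrow> real^'n \<Rightarrow> real^'n^'n" where
  "hessian \<phi> v = jacobian (gradient \<phi>) (at v)"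

text \<open>The entry \<open>(i, j)\<close> of the mixed Hessian is \<open>\<partial>\<^sup>2\<phi> / \<partial>a\<^sub>i \<partial>b\<^sub>j\<close>: rows follow the first argument.\<close>

definition mixed_hessian ::
  "(real^'a \<Rightarrow> real^'b \<Rightarrow> real) \<Rightarrow> real^'a \<Rightarrow> real^'b \<Rightarrow> real^'b^'a" where
  "mixed_hessian \<phi> a b = jacobian (\<lambda>b'. gradient (\<lambda>a'. \<phi> a' b') a) (at b)"

record ('x, 'u, 'd) ocp =
  dyn :: "nat \<Rightarrow> real^'x \<Rightarrow> real^'u \<Rightarrow> real^'d \<Rightarrow> real^'x"
  stage_cost :: "nat \<Rightarrow> real^'x \<Rightarrow> real^'u \<Rightarrow> real^'d \<Rightarrow> real"
  final_cost :: "real^'x \<Rightarrow> real^'d \<Rightarrow> real"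

definition smooth_ocp :: "nat \<Rightarrow> ('x::finite, 'u::finite, 'd::finite) ocp \<Rightarrow> bool" where
  "smooth_ocp N P \<longleftrightarrow>
    (\<forall>k<N. twice_continuously_differentiable (\<lambda>(x, u, d). dyn P k x u d)) \<and>
    (\<forall>k<N. twice_continuously_differentiable (\<lambda>(x, u, d). stage_cost P k x u d)) \<and>
    twice_continuously_differentiable (\<lambda>(x, d). final_cost P x d)"

definition ocp_feasible ::
  "nat \<Rightarrow> ('x::finite, 'u::finite, 'd::finite) ocp \<Rightarrow> real^'x \<Rightarrow> (nat \<Rightarrow> real^'d) \<Rightarrow>
   (nat \<Rightarrow> real^'x) \<Rightarrow> (nat \<Rightarrow> real^'u) \<Rightarrow> bool" where
  "ocp_feasible N P xbar d x u \<longleftrightarrow>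
    x 0 = xbar \<and> (\<forall>k<N. x (Suc k) = dyn P k (x k) (u k) (d k))"

definition ocp_cost ::
  "nat \<Rightarrow> ('x::finite, 'u::finite, 'd::finite) ocp \<Rightarrow> (nat \<Rightarrow> real^'d) \<Rightarrow>
   (nat \<Rightarrow> real^'x) \<Rightarrow> (nat \<Rightarrow> real^'u) \<Rightarrow> real" where
  "ocp_cost N P d x u = (\<Sum>k<N. stage_cost P k (x k) (u k) (d k)) + final_cost P (x N) (d N)"

definition stage_lagrangian ::
  "('x::finite, 'u::finite, 'd::finite) ocp \<Rightarrow> (nat \<Rightarrow> real^'x) \<Rightarrow> nat \<Rightarrow>
   real^'x \<Rightarrow> real^'u \<Rightarrow> real^'d \<Rightarrow> real" where
  "stage_lagrangian P lam k x u d =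
    stage_cost P k x u d + lam k \<bullet> x - lam (Suc k) \<bullet> dyn P k x u d"

definition final_lagrangian ::
  "nat \<Rightarrow> ('x::finite, 'u::finite, 'd::finite) ocp \<Rightarrow> (nat \<Rightarrow> real^'x) \<Rightarrow>
   real^'x \<Rightarrow> real^'d \<Rightarrow> real" where
  "final_lagrangian N P lam x d = final_cost P x d + lam N \<bullet> x"

definition ocp_lagrangian ::
  "nat \<Rightarrow> ('x::finite, 'u::finite, 'd::finite) ocp \<Rightarrow> real^'x \<Rightarrow> (nat \<Rightarrow> real^'d) \<Rightarrow>
   (nat \<Rightarrow> real^'x) \<Rightarrow> (nat \<Rightarrow> real^'u) \<Rightarrow> (nat \<Rightarrow> real^'x) \<Rightarrow> real" where
  "ocp_lagrangian N P xbar d x u lam =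
    (\<Sum>k<N. stage_lagrangian P lam k (x k) (u k) (d k)) + final_lagrangian N P lam (x N) (d N)
    - lam 0 \<bullet> xbar"

definition ocp_local_minimizer ::
  "nat \<Rightarrow> ('x::finite, 'u::finite, 'd::finite) ocp \<Rightarrow> real^'x \<Rightarrow> (nat \<Rightarrow> real^'d) \<Rightarrow>
   (nat \<Rightarrow> real^'x) \<Rightarrow> (nat \<Rightarrow> real^'u) \<Rightarrow> bool" where
  "ocp_local_minimizer N P xbar d x u \<longleftrightarrow>
    ocp_feasible N P xbar d x u \<and>
    (\<exists>\<epsilon>>0. \<forall>x' u'. ocp_feasible N P xbar d x' u' \<longrightarrow>
      (\<forall>k\<le>N. dist (x' k) (x k) < \<epsilon>) \<longrightarrow> (\<forall>k<N. dist (u' k) (u k) < \<epsilon>) \<longrightarrow>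
      ocp_cost N P d x u \<le> ocp_cost N P d x' u')"

definition ocp_local_primal_dual_solution ::
  "nat \<Rightarrow> ('x::finite, 'u::finite, 'd::finite) ocp \<Rightarrow> real^'x \<Rightarrow> (nat \<Rightarrow> real^'d) \<Rightarrow>
   (nat \<Rightarrow> real^'x) \<Rightarrow> (nat \<Rightarrow> real^'u) \<Rightarrow> (nat \<Rightarrow> real^'x) \<Rightarrow> bool" where
  "ocp_local_primal_dual_solution N P xbar d x u lam \<longleftrightarrow>
    ocp_local_minimizer N P xbar d x u \<and>
    (\<forall>k\<le>N. ((\<lambda>v. ocp_lagrangian N P xbar d (x(k := v)) u lam) has_derivative (\<lambda>_. 0)) (at (x k))) \<and>
    (\<forall>k<N. ((\<lambda>v. ocp_lagrangian N P xbar d x (u(k := v)) lam) has_derivative (\<lambda>_. 0)) (at (u k)))"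

text \<open>
  \<open>Qm\<close> and \<open>D1m\<close> are used at stages \<open>0, \<dots>, N\<close> (with \<open>D1m N\<close> playing the role of \<open>D\<^sub>N\<close>), all other
  fields at stages \<open>0, \<dots>, N - 1\<close>.
\<close>

record ('x, 'u, 'd) lq =
  Am :: "nat \<Rightarrow> real^'x^'x"
  Bm :: "nat \<Rightarrow> real^'u^'x"
  Cm :: "nat \<Rightarrow> real^'d^'x"
  Qm :: "nat \<Rightarrow> real^'x^'x"
  Sm :: "nat \<Rightarrow> real^'x^'u"
  Rm :: "nat \<Rightarrow> real^'u^'u"
  D1m :: "nat \<Rightarrow> real^'x^'d"
  D2m :: "nat \<Rightarrow> real^'u^'d"

definition lq_of_ocp ::
  "nat \<Rightarrow> ('x::finite, 'u::finite, 'd::finite) ocp \<Rightarrow> (nat \<Rightarrow> real^'d) \<Rightarrow>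
   (nat \<Rightarrow> real^'x) \<Rightarrow> (nat \<Rightarrow> real^'u) \<Rightarrow> (nat \<Rightarrow> real^'x) \<Rightarrow> ('x, 'u, 'd) lq" where
  "lq_of_ocp N P d x u lam = \<lparr>
    Am = (\<lambda>k. jacobian (\<lambda>v. dyn P k v (u k) (d k)) (at (x k))),
    Bm = (\<lambda>k. jacobian (\<lambda>v. dyn P k (x k) v (d k)) (at (u k))),
    Cm = (\<lambda>k. jacobian (\<lambda>v. dyn P k (x k) (u k) v) (at (d k))),
    Qm = (\<lambda>k. if k < N then hessian (\<lambda>v. stage_lagrangian P lam k v (u k) (d k)) (x k)
              else hessian (\<lambda>v. final_lagrangian N P lam v (d N)) (x N)),
    Sm = (\<lambda>k. mixed_hessian (\<lambda>u' x'. stage_lagrangian P lam k x' u' (d k)) (u k) (x k)),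
    Rm = (\<lambda>k. hessian (\<lambda>v. stage_lagrangian P lam k (x k) v (d k)) (u k)),
    D1m = (\<lambda>k. if k < N then
                 mixed_hessian (\<lambda>d' x'. stage_lagrangian P lam k x' (u k) d') (d k) (x k)
               else mixed_hessian (\<lambda>d' x'. final_lagrangian N P lam x' d') (d N) (x N)),
    D2m = (\<lambda>k. mixed_hessian (\<lambda>d' u'. stage_lagrangian P lam k (x k) u' d') (d k) (u k)) \<rparr>"

text \<open>
  The coordinates of \<open>z = (x\<^sub>0; u\<^sub>0; \<dots>; x\<^sub>N\<^sub>-\<^sub>1; u\<^sub>N\<^sub>-\<^sub>1; x\<^sub>N)\<close> are \<open>Inl (k, i)\<close> for the \<open>i\<close>-th component of
  \<open>x\<^sub>k\<close> and \<open>Inr (k, i)\<close> for the \<open>i\<close>-th component of \<open>u\<^sub>k\<close>. Since their number depends on \<open>N\<close>,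
  matrices acting on \<open>z\<close> are functions of two indices. Row \<open>(0, i)\<close> of the constraint Jacobian is
  the initial condition and row \<open>(Suc k, i)\<close> the dynamics of stage \<open>k\<close>.
\<close>

type_synonym ('x, 'u) coord = "(nat \<times> 'x) + (nat \<times> 'u)"

definition z_coords :: "nat \<Rightarrow> ('x, 'u) coord set" where
  "z_coords N = ({..N} \<times> UNIV) <+> ({..<N} \<times> UNIV)"

definition constraint_rows :: "nat \<Rightarrow> (nat \<times> 'x) set" where
  "constraint_rows N = {..N} \<times> UNIV"

fun full_hessian ::
  "('x::finite, 'u::finite, 'd::finite) lq \<Rightarrow> ('x, 'u) coord \<Rightarrow> ('x, 'u) coord \<Rightarrow> real" where
  "full_hessian D (Inl (k, i)) (Inl (k', j)) = (if k = k' then Qm D k $ i $ j else 0)"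
| "full_hessian D (Inl (k, i)) (Inr (k', j)) = (if k = k' then transpose (Sm D k) $ i $ j else 0)"
| "full_hessian D (Inr (k, i)) (Inl (k', j)) = (if k = k' then Sm D k $ i $ j else 0)"
| "full_hessian D (Inr (k, i)) (Inr (k', j)) = (if k = k' then Rm D k $ i $ j else 0)"

fun constraint_jacobian ::
  "('x::finite, 'u::finite, 'd::finite) lq \<Rightarrow> nat \<times> 'x \<Rightarrow> ('x, 'u) coord \<Rightarrow> real" where
  "constraint_jacobian D (r, i) (Inl (k, j)) =
     (if k = r \<and> j = i then 1 else 0) - (if r = Suc k then Am D k $ i $ j else 0)"
| "constraint_jacobian D (r, i) (Inr (k, j)) = - (if r = Suc k then Bm D k $ i $ j else 0)"

definition constraint_kernel ::
  "nat \<Rightarrow> ('x::finite, 'u::finite, 'd::finite) lq \<Rightarrow> (('x, 'u) coord \<Rightarrow> real) set" where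
  "constraint_kernel N D =
    {z. \<forall>r\<in>constraint_rows N. (\<Sum>c\<in>z_coords N. constraint_jacobian D r c * z c) = 0}"

text \<open>\<open>Z c j\<close> is the entry of \<open>Z\<close> in row \<open>c\<close> and column \<open>j < m\<close>.\<close>

definition orthonormal_kernel_basis ::
  "nat \<Rightarrow> ('x::finite, 'u::finite, 'd::finite) lq \<Rightarrow> nat \<Rightarrow> (('x, 'u) coord \<Rightarrow> nat \<Rightarrow> real) \<Rightarrow> bool" where
  "orthonormal_kernel_basis N D m Z \<longleftrightarrow>
    (\<forall>j<m. (\<lambda>c. Z c j) \<in> constraint_kernel N D) \<and>
    (\<forall>i<m. \<forall>j<m. (\<Sum>c\<in>z_coords N. Z c i * Z c j) = (if i = j then 1 else 0)) \<and>
    (\<forall>z\<in>constraint_kernel N D. \<exists>a. \<forall>c\<in>z_coords N. z c = (\<Sum>j<m. Z c j * a j))"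

definition reduced_hessian ::
  "nat \<Rightarrow> ('x::finite, 'u::finite, 'd::finite) lq \<Rightarrow> (('x, 'u) coord \<Rightarrow> nat \<Rightarrow> real) \<Rightarrow>
   nat \<Rightarrow> nat \<Rightarrow> real" where
  "reduced_hessian N D Z i j =
    (\<Sum>a\<in>z_coords N. \<Sum>b\<in>z_coords N. Z a i * full_hessian D a b * Z b j)"

text \<open>The Loewner order \<open>M \<succeq> \<gamma> I\<close> for an \<open>m \<times> m\<close> matrix \<open>M\<close>.\<close>

definition succeq_scaled_id :: "nat \<Rightarrow> (nat \<Rightarrow> nat \<Rightarrow> real) \<Rightarrow> real \<Rightarrow> bool" where
  "succeq_scaled_id m M \<gamma> \<longleftrightarrow>
    (\<forall>v. (\<Sum>i<m. \<Sum>j<m. v i * M i j * v j) \<ge> \<gamma> * (\<Sum>i<m. (v i)\<^sup>2))"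

definition lqp_feasible ::
  "nat \<Rightarrow> ('x::finite, 'u::finite, 'd::finite) lq \<Rightarrow> real^'x \<Rightarrow> (nat \<Rightarrow> real^'d) \<Rightarrow>
   (nat \<Rightarrow> real^'x) \<Rightarrow> (nat \<Rightarrow> real^'u) \<Rightarrow> bool" where
  "lqp_feasible N D linit l p q \<longleftrightarrow>
    p 0 = linit \<and>
    (\<forall>k<N. p (Suc k) = Am D k *v p k + Bm D k *v q k + Cm D k *v l k)"

definition lqp_cost ::
  "nat \<Rightarrow> ('x::finite, 'u::finite, 'd::finite) lq \<Rightarrow> (nat \<Rightarrow> real^'d) \<Rightarrow>
   (nat \<Rightarrow> real^'x) \<Rightarrow> (nat \<Rightarrow> real^'u) \<Rightarrow> real" where
  "lqp_cost N D l p q =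
    (\<Sum>k<N.
      p k \<bullet> (Qm D k *v p k + transpose (Sm D k) *v q k + transpose (D1m D k) *v l k) +
      q k \<bullet> (Sm D k *v p k + Rm D k *v q k + transpose (D2m D k) *v l k) +
      l k \<bullet> (D1m D k *v p k + D2m D k *v q k)) +
    (p N \<bullet> (Qm D N *v p N + transpose (D1m D N) *v l N) + l N \<bullet> (D1m D N *v p N))"

definition lqp_lagrangian ::
  "nat \<Rightarrow> ('x::finite, 'u::finite, 'd::finite) lq \<Rightarrow> real^'x \<Rightarrow> (nat \<Rightarrow> real^'d) \<Rightarrow>
   (nat \<Rightarrow> real^'x) \<Rightarrow> (nat \<Rightarrow> real^'u) \<Rightarrow> (nat \<Rightarrow> real^'x) \<Rightarrow> real" where
  "lqp_lagrangian N D linit l p q \<zeta> =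
    lqp_cost N D l p q +
    (\<Sum>k<N. \<zeta> (Suc k) \<bullet> (p (Suc k) - Am D k *v p k - Bm D k *v q k - Cm D k *v l k)) +
    \<zeta> 0 \<bullet> (p 0 - linit)"

definition lqp_primal_solution ::
  "nat \<Rightarrow> ('x::finite, 'u::finite, 'd::finite) lq \<Rightarrow> real^'x \<Rightarrow> (nat \<Rightarrow> real^'d) \<Rightarrow>
   (nat \<Rightarrow> real^'x) \<Rightarrow> (nat \<Rightarrow> real^'u) \<Rightarrow> bool" where
  "lqp_primal_solution N D linit l p q \<longleftrightarrow>
    lqp_feasible N D linit l p q \<and>
    (\<forall>p' q'. lqp_feasible N D linit l p' q' \<longrightarrow> lqp_cost N D l p q \<le> lqp_cost N D l p' q')"

definition lqp_dual_solution ::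
  "nat \<Rightarrow> ('x::finite, 'u::finite, 'd::finite) lq \<Rightarrow> real^'x \<Rightarrow> (nat \<Rightarrow> real^'d) \<Rightarrow>
   (nat \<Rightarrow> real^'x) \<Rightarrow> (nat \<Rightarrow> real^'u) \<Rightarrow> (nat \<Rightarrow> real^'x) \<Rightarrow> bool" where
  "lqp_dual_solution N D linit l p q \<zeta> \<longleftrightarrow>
    (\<forall>k\<le>N. ((\<lambda>v. lqp_lagrangian N D linit l (p(k := v)) q \<zeta>) has_derivative (\<lambda>_. 0)) (at (p k))) \<and>
    (\<forall>k<N. ((\<lambda>v. lqp_lagrangian N D linit l p (q(k := v)) \<zeta>) has_derivative (\<lambda>_. 0)) (at (q k)))"

function Kr :: "nat \<Rightarrow> ('x::finite, 'u::finite, 'd::finite) lq \<Rightarrow> nat \<Rightarrow> real^'x^'x" where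
  "Kr N D k =
    (if k < N then
       let K = Kr N D (Suc k);
           W = Rm D k + transpose (Bm D k) ** K ** Bm D k;
           F = transpose (Bm D k) ** K ** Am D k + Sm D k
       in Qm D k + transpose (Am D k) ** K ** Am D k - transpose F ** matrix_inv W ** F
     else Qm D N)"
  by pat_completeness auto
termination by (relation "Wellfounded.measure (\<lambda>(N, D, k). N - k)") auto

declare Kr.simps [simp del]

definition Wr :: "nat \<Rightarrow> ('x::finite, 'u::finite, 'd::finite) lq \<Rightarrow> nat \<Rightarrow> real^'u^'u" where
  "Wr N D k = Rm D k + transpose (Bm D k) ** Kr N D (Suc k) ** Bm D k"

definition Pr :: "nat \<Rightarrow> ('x::finite, 'u::finite, 'd::finite) lq \<Rightarrow> nat \<Rightarrow> real^'x^'u" where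
  "Pr N D k =
    - (matrix_inv (Wr N D k) ** (transpose (Bm D k) ** Kr N D (Suc k) ** Am D k + Sm D k))"

definition Er :: "nat \<Rightarrow> ('x::finite, 'u::finite, 'd::finite) lq \<Rightarrow> nat \<Rightarrow> real^'x^'x" where
  "Er N D k = Am D k + Bm D k ** Pr N D k"

text \<open>
  The product \<open>E\<^sub>n\<^sub>-\<^sub>1 \<cdots> E\<^sub>m\<close> over the half-open range \<open>m \<le> j < n\<close>; the identity if the range is empty.
\<close>

primrec Eprod ::
  "nat \<Rightarrow> ('x::finite, 'u::finite, 'd::finite) lq \<Rightarrow> nat \<Rightarrow> nat \<Rightarrow> real^'x^'x" where
  "Eprod N D m 0 = mat 1"
| "Eprod N D m (Suc n) = (if m \<le> n then Er N D n ** Eprod N D m n else mat 1)"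

text \<open>\<open>Vr N D i k\<close> is \<open>V\<^sub>i\<^sup>k\<close> and \<open>Mr N D i k\<close> is \<open>M\<^sub>i\<^sup>k\<close>; in the latter \<open>D\<^sub>N\<^sub>2 P\<^sub>N\<close> is read as \<open>0\<close>.\<close>

definition Vr :: "nat \<Rightarrow> ('x::finite, 'u::finite, 'd::finite) lq \<Rightarrow> nat \<Rightarrow> nat \<Rightarrow> real^'x^'x" where
  "Vr N D i k = - (Kr N D (Suc i) ** Eprod N D k (Suc i))"

definition Mr :: "nat \<Rightarrow> ('x::finite, 'u::finite, 'd::finite) lq \<Rightarrow> nat \<Rightarrow> nat \<Rightarrow> real^'x^'d" where
  "Mr N D i k =
    - ((if i < N then D1m D i + D2m D i ** Pr N D i else D1m D N) ** Eprod N D k i)"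

definition S_tilde :: "('x::finite, 'u::finite, 'd::finite) lq \<Rightarrow> nat \<Rightarrow> real^'x^'x \<Rightarrow> real^'x^'u" where
  "S_tilde D k Qbar' = Sm D k + transpose (Bm D k) ** Qbar' ** Am D k"

definition R_tilde :: "('x::finite, 'u::finite, 'd::finite) lq \<Rightarrow> nat \<Rightarrow> real^'x^'x \<Rightarrow> real^'u^'u" where
  "R_tilde D k Qbar' = Rm D k + transpose (Bm D k) ** Qbar' ** Bm D k"

definition Q_tilde ::
  "real \<Rightarrow> ('x::finite, 'u::finite, 'd::finite) lq \<Rightarrow> nat \<Rightarrow> real^'x^'x \<Rightarrow> real^'x^'x" where
  "Q_tilde \<beta> D k Qbar' =
    transpose (S_tilde D k Qbar') ** matrix_inv (R_tilde D k Qbar') ** S_tilde D k Qbar' + mat \<beta>"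

definition Q_hat :: "('x::finite, 'u::finite, 'd::finite) lq \<Rightarrow> nat \<Rightarrow> real^'x^'x \<Rightarrow> real^'x^'x" where
  "Q_hat D k Qbar' = Qm D k + transpose (Am D k) ** Qbar' ** Am D k"

function Q_bar ::
  "nat \<Rightarrow> real \<Rightarrow> ('x::finite, 'u::finite, 'd::finite) lq \<Rightarrow> nat \<Rightarrow> real^'x^'x" where
  "Q_bar N \<beta> D k =
    (if k < N then
       Q_hat D k (Q_bar N \<beta> D (Suc k)) - Q_tilde \<beta> D k (Q_bar N \<beta> D (Suc k))
     else Qm D N - mat \<beta>)"
  by pat_completeness auto
termination by (relation "Wellfounded.measure (\<lambda>(N, \<beta>, D, k). N - k)") auto

declare Q_bar.simps [simp del]

definition convexify ::
  "nat \<Rightarrow> real \<Rightarrow> ('x::finite, 'u::finite, 'd::finite) lq \<Rightarrow> ('x, 'u, 'd) lq" where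
  "convexify N \<beta> D = D \<lparr>
    Qm := (\<lambda>k. if k < N then Q_tilde \<beta> D k (Q_bar N \<beta> D (Suc k)) else mat \<beta>),
    Sm := (\<lambda>k. S_tilde D k (Q_bar N \<beta> D (Suc k))),
    Rm := (\<lambda>k. R_tilde D k (Q_bar N \<beta> D (Suc k))),
    D1m := (\<lambda>k. if k < N then
                  D1m D k + transpose (Cm D k) ** Q_bar N \<beta> D (Suc k) ** Am D k
                else D1m D N),
    D2m := (\<lambda>k. D2m D k + transpose (Cm D k) ** Q_bar N \<beta> D (Suc k) ** Bm D k) \<rparr>"

end

theory Submission
  imports Defs
begin

text \<open>
  Stationarity of the Lagrangian in \<open>q\<^sub>k\<close> and \<open>p\<^sub>k\<close> gives a backward recursion for \<open>\<zeta>\<close>. Inserting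
  \<open>\<zeta>\<^sub>k = - 2 K\<^sub>k\<^sub>+\<^sub>1 p\<^sub>k\<^sub>+\<^sub>1 + 2 s\<^sub>k\<^sub>+\<^sub>1\<close> into the equation for \<open>q\<^sub>k\<close> and solving with \<open>W\<^sub>k\<close> reproduces this form
  one stage earlier. This needs \<open>Q\<^sub>k\<close>, \<open>R\<^sub>k\<close> symmetric (second derivatives commute) and \<open>W\<^sub>k\<close> invertible;
  the latter holds because \<open>v\<^sup>T W\<^sub>k v\<close> is the value of the reduced quadratic form at a trajectory.

  For the convexified problem one has \<open>K - Q_bar\<close> in place of \<open>K\<close> and the same \<open>W\<^sub>k\<close>, whatever \<open>\<beta>\<close> is. The
  condition \<open>\<beta> < \<gamma>\<close> only ensures that \<open>R_tilde\<close> is invertible: \<open>matrix_inv\<close> of a singular matrix is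
  unspecified, so that \<open>Q_tilde\<close> might fail to be symmetric.
\<close>

declare transpose_matrix_vector [simp del]

subsection \<open>Symmetry of second derivatives\<close>

text \<open>The mean value theorem in direction \<open>s *\<^sub>R k\<close> turns the second
  difference into a difference of two values of \<open>f'\<close>. Both are compared with the
  linearization of \<open>\<lambda>y. f' y k\<close> at \<open>a\<close>, each with error
  \<open>e\<close> times the distance from \<open>a\<close>.\<close>

lemma second_difference_estimate:
  fixes f :: "'a::real_normed_vector \<Rightarrow> real"
  assumes f: "\<And>y. (f has_derivative f' y) (at y)"
    and F: "((\<lambda>y. f' y k) has_derivative Fk) (at a)"
    and e: "e > 0"
  shows "\<forall>\<^sub>F s in at_right 0. \<bar>f (a + s *\<^sub>R h + s *\<^sub>R k) - f (a + s *\<^sub>R h) - f (a + s *\<^sub>R k) + f a - s\<^sup>2 * Fk h\<bar>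
     \<le> 2 * e * s\<^sup>2 * (norm h + norm k)"
proof -
  from F obtain \<delta> where \<delta>: "\<delta> > 0"
    and d: "\<And>y. norm (y - a) < \<delta> \<Longrightarrow> norm (f' y k - f' a k - Fk (y - a)) \<le> e * norm (y - a)"
    unfolding has_derivative_at_alt using e by blast
  interpret Fk: bounded_linear Fk using F by (rule has_derivative_bounded_linear)
  \<comment> \<open>For \<open>s < r\<close> both evaluation points stay within
    \<open>\<delta>\<close> of \<open>a\<close>; the added 1 covers the case
    \<open>h = k = 0\<close>.\<close>
  define r where "r = \<delta> / (norm h + norm k + 1)"
  have r: "r > 0" unfolding r_def using \<delta> by (simp add: add_nonneg_pos)
  have "\<bar>f (a + s *\<^sub>R h + s *\<^sub>R k) - f (a + s *\<^sub>R h) - f (a + s *\<^sub>R k) + f a - s\<^sup>2 * Fk h\<bar>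
     \<le> 2 * e * s\<^sup>2 * (norm h + norm k)" if s: "0 < s" "s < r" for s
  proof -
    let ?\<phi> = "\<lambda>t. f (a + s *\<^sub>R h + t *\<^sub>R (s *\<^sub>R k)) - f (a + t *\<^sub>R (s *\<^sub>R k))"
    let ?\<phi>' = "\<lambda>t u. f' (a + s *\<^sub>R h + t *\<^sub>R (s *\<^sub>R k)) (u *\<^sub>R (s *\<^sub>R k)) - f' (a + t *\<^sub>R (s *\<^sub>R k)) (u *\<^sub>R (s *\<^sub>R k))"
    have der: "(?\<phi> has_derivative ?\<phi>' t) (at t within {0..1})" for t
      by (rule has_derivative_diff; rule has_derivative_compose[OF _ f])
        (auto intro!: derivative_eq_intros)
    obtain t where t: "t \<in> {0..1}" and eq: "?\<phi> 1 - ?\<phi> 0 = ?\<phi>' t (1 - 0)"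
      using mvt_very_simple[of 0 1 ?\<phi> ?\<phi>'] der by auto
    have lin: "f' y (s *\<^sub>R k) = s * f' y k" for y
      using has_derivative_linear[OF f[of y]] by (simp add: linear_cmul)
    let ?y1 = "a + s *\<^sub>R h + t *\<^sub>R (s *\<^sub>R k)" and ?y2 = "a + t *\<^sub>R (s *\<^sub>R k)"
    have sr: "s * (norm h + norm k) < \<delta>"
    proof -
      have "s * (norm h + norm k) \<le> s * (norm h + norm k + 1)" using s by simp
      also have "\<dots> < r * (norm h + norm k + 1)" using s by (intro mult_strict_right_mono) (auto simp: add_nonneg_pos)
      also have "\<dots> = \<delta>" 
      proof -
        have "norm h + norm k + 1 > 0" by (simp add: add_nonneg_pos)
        then show ?thesis unfolding r_def by simp
      qed
      finally show ?thesis .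
    qed
    have tk: "norm (t *\<^sub>R (s *\<^sub>R k)) \<le> s * norm k"
      using t s by (simp add: mult_left_le_one_le)
    have n2: "norm (?y2 - a) \<le> s * (norm h + norm k)"
      using tk s norm_ge_zero[of h] by (simp add: algebra_simps)
        (smt (verit) mult_nonneg_nonneg norm_ge_zero)
    have n1: "norm (?y1 - a) \<le> s * (norm h + norm k)"
    proof -
      have "norm (?y1 - a) \<le> norm (s *\<^sub>R h) + norm (t *\<^sub>R (s *\<^sub>R k))"
        using norm_triangle_ineq[of "s *\<^sub>R h" "t *\<^sub>R (s *\<^sub>R k)"] by (simp add: algebra_simps)
      then show ?thesis using tk s by (simp add: algebra_simps)
    qed
    have b1: "\<bar>f' ?y1 k - f' a k - Fk (?y1 - a)\<bar> \<le> e * (s * (norm h + norm k))"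
      using d[of ?y1] n1 sr e by (smt (verit) mult_left_mono real_norm_def)
    have b2: "\<bar>f' ?y2 k - f' a k - Fk (?y2 - a)\<bar> \<le> e * (s * (norm h + norm k))"
      using d[of ?y2] n2 sr e by (smt (verit) mult_left_mono real_norm_def)
    \<comment> \<open>The two points differ by \<open>s *\<^sub>R h\<close>, and the direction
      \<open>s *\<^sub>R k\<close> contributes another factor \<open>s\<close>; hence the
      \<open>s\<^sup>2\<close> of the estimate.\<close>
    have FF: "Fk (?y1 - a) - Fk (?y2 - a) = s * Fk h"
      by (simp add: Fk.add Fk.scaleR)
    have "\<bar>f' ?y1 k - f' ?y2 k - s * Fk h\<bar> \<le> 2 * (e * (s * (norm h + norm k)))"
      using b1 b2 FF by linarith
    then have "s * \<bar>f' ?y1 k - f' ?y2 k - s * Fk h\<bar> \<le> s * (2 * (e * (s * (norm h + norm k))))"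
      using s by (intro mult_left_mono) auto
    moreover have "s * \<bar>f' ?y1 k - f' ?y2 k - s * Fk h\<bar> = \<bar>s * (f' ?y1 k - f' ?y2 k - s * Fk h)\<bar>"
      using s by (simp add: abs_mult)
    moreover have "s * (f' ?y1 k - f' ?y2 k - s * Fk h) = ?\<phi> 1 - ?\<phi> 0 - s\<^sup>2 * Fk h"
      unfolding eq by (simp add: lin algebra_simps power2_eq_square)
    ultimately show ?thesis by (simp add: algebra_simps power2_eq_square)
  qed
  then show ?thesis
    unfolding eventually_at_right_field using r by blast
qed

text \<open>The second difference is symmetric in \<open>h\<close> and \<open>k\<close>, and the
  estimate pins it both to \<open>s\<^sup>2 * Fk h\<close> and to \<open>s\<^sup>2 * Fh k\<close>.
  Division by \<open>s\<^sup>2\<close> leaves a multiple of the arbitrary \<open>e\<close>.\<close>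

lemma second_derivative_symmetric:
  fixes f :: "'a::real_normed_vector \<Rightarrow> real"
  assumes f: "\<And>y. (f has_derivative f' y) (at y)"
    and k: "((\<lambda>y. f' y k) has_derivative Fk) (at a)"
    and h: "((\<lambda>y. f' y h) has_derivative Fh) (at a)"
  shows "Fk h = Fh k"
proof -
  have "\<bar>Fk h - Fh k\<bar> \<le> 4 * (norm h + norm k) * e" if e: "e > 0" for e
  proof -
    have "\<forall>\<^sub>F s in at_right (0::real). s > 0" by (simp add: eventually_at_right_less)
    with second_difference_estimate[OF f k e, of h] second_difference_estimate[OF f h e, of k]
    have "\<forall>\<^sub>F s in at_right (0::real). \<bar>Fk h - Fh k\<bar> \<le> 4 * (norm h + norm k) * e"
    proof eventually_elim
      case (elim s)
      have "\<bar>s\<^sup>2 * Fk h - s\<^sup>2 * Fh k\<bar> \<le> 2 * (2 * e * s\<^sup>2 * (norm h + norm k))"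
        using elim(1,2) by (simp add: add.commute add.left_commute)
      then have "s\<^sup>2 * \<bar>Fk h - Fh k\<bar> \<le> s\<^sup>2 * (4 * (norm h + norm k) * e)"
        by (simp add: right_diff_distrib[symmetric] abs_mult) (simp add: algebra_simps)
      then show ?case using elim(3) by simp
    qed
    then show ?thesis using eventually_happens'[OF trivial_limit_at_right_real] by blast
  qed
  then have "\<bar>Fk h - Fh k\<bar> \<le> 0 + e'" if "e' > 0" for e'
  proof -
    have pos: "4 * (norm h + norm k) + 1 > 0" by (simp add: add_nonneg_pos)
    then have "\<bar>Fk h - Fh k\<bar> \<le> 4 * (norm h + norm k) * (e' / (4 * (norm h + norm k) + 1))"
      using that by (intro \<open>\<And>e. e > 0 \<Longrightarrow> \<bar>Fk h - Fh k\<bar> \<le> 4 * (norm h + norm k) * e\<close>) simp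
    also have "\<dots> \<le> e'" using pos that by (simp add: field_simps)
    finally show ?thesis by simp
  qed
  then have "\<bar>Fk h - Fh k\<bar> \<le> 0" by (rule field_le_epsilon)
  then show ?thesis by simp
qed

text \<open>The second derivative is taken direction by direction and only at \<open>a\<close>: this
  matches the hypotheses of \<open>second_derivative_symmetric\<close> and is preserved by sums and
  bounded linear images.\<close>

definition twice_differentiable_at ::
  "('a::real_normed_vector \<Rightarrow> 'b::real_normed_vector) \<Rightarrow> 'a \<Rightarrow> bool" where
  "twice_differentiable_at f a \<longleftrightarrow>
    (\<exists>f' f''. (\<forall>y. (f has_derivative f' y) (at y)) \<and> (\<forall>h. ((\<lambda>y. f' y h) has_derivative f'' h) (at a)))"

text \<open>Entry \<open>(i, j)\<close> of the Hessian is
  \<open>\<phi>'' (axis i 1) (axis j 1)\<close>, to which the symmetry of second derivatives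
  applies.\<close>

lemma transpose_hessian:
  assumes "twice_differentiable_at \<phi> a"
  shows "transpose (hessian \<phi> a) = hessian \<phi> a"
proof -
  obtain \<phi>' \<phi>'' where 1: "\<And>y. (\<phi> has_derivative \<phi>' y) (at y)"
    and 2: "\<And>h. ((\<lambda>y. \<phi>' y h) has_derivative \<phi>'' h) (at a)"
    using assms unfolding twice_differentiable_at_def by blast
  have g: "gradient \<phi> = (\<lambda>y. \<chi> i. \<phi>' y (axis i 1))"
    unfolding gradient_def using frechet_derivative_at[OF 1] by auto
  have "(gradient \<phi> has_derivative (\<lambda>v. \<chi> i. \<phi>'' (axis i 1) v)) (at a)"
    unfolding g by (subst has_derivative_componentwise_within)
      (auto simp: Basis_vec_def inner_axis intro: 2)
  then have "hessian \<phi> a = matrix (\<lambda>v. \<chi> i. \<phi>'' (axis i 1) v)"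
    unfolding hessian_def jacobian_def using frechet_derivative_at by metis
  then have "hessian \<phi> a $ i $ j = \<phi>'' (axis i 1) (axis j 1)" for i j
    by (simp add: matrix_def)
  moreover have "\<phi>'' (axis i 1) (axis j 1) = \<phi>'' (axis j 1) (axis i 1)" for i j
    by (rule second_derivative_symmetric[OF 1 2 2])
  ultimately show ?thesis by (simp add: transpose_def vec_eq_iff)
qed

text \<open>Serves to freeze arguments: \<open>c\<close> holds the fixed ones and \<open>L\<close>
  embeds the free one into the product space.\<close>

lemma twice_differentiable_at_affine:
  assumes F: "twice_continuously_differentiable F" and L: "bounded_linear L"
  shows "twice_differentiable_at (\<lambda>y. F (c + L y)) a"
proof -
  obtain F' F'' where 1: "\<And>y. (F has_derivative blinfun_apply (F' y)) (at y)"
    and 2: "\<And>y. (F' has_derivative blinfun_apply (F'' y)) (at y)"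
    using F unfolding twice_continuously_differentiable_def by blast
  have \<iota>: "((\<lambda>y. c + L y) has_derivative L) (at y)" for y
    by (auto intro!: derivative_eq_intros bounded_linear_imp_has_derivative[OF L])
  show ?thesis
    unfolding twice_differentiable_at_def
  proof (intro exI conjI allI)
    show "((\<lambda>y. F (c + L y)) has_derivative (\<lambda>h. F' (c + L y) (L h))) (at y)" for y
      by (rule has_derivative_compose[OF \<iota> 1])
    show "((\<lambda>y. F' (c + L y) (L h)) has_derivative (\<lambda>w. F'' (c + L a) (L w) (L h))) (at a)" for h
      by (rule bounded_linear.has_derivative[OF blinfun.bounded_linear_left has_derivative_compose[OF \<iota> 2]])
  qed
qed

lemma twice_differentiable_at_add:
  assumes "twice_differentiable_at f a" "twice_differentiable_at g a"
  shows "twice_differentiable_at (\<lambda>y. f y + g y) a"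
proof -
  obtain f' f'' g' g'' where "\<And>y. (f has_derivative f' y) (at y)" "\<And>h. ((\<lambda>y. f' y h) has_derivative f'' h) (at a)"
     "\<And>y. (g has_derivative g' y) (at y)" "\<And>h. ((\<lambda>y. g' y h) has_derivative g'' h) (at a)"
    using assms unfolding twice_differentiable_at_def by blast
  then show ?thesis unfolding twice_differentiable_at_def
    by (intro exI[of _ "\<lambda>y h. f' y h + g' y h"] exI[of _ "\<lambda>h w. f'' h w + g'' h w"])
      (auto intro!: has_derivative_add)
qed

lemma twice_differentiable_at_bounded_linear:
  assumes "twice_differentiable_at f a" and L: "bounded_linear L"
  shows "twice_differentiable_at (\<lambda>y. L (f y)) a"
proof -
  obtain f' f'' where "\<And>y. (f has_derivative f' y) (at y)" "\<And>h. ((\<lambda>y. f' y h) has_derivative f'' h) (at a)"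
    using assms unfolding twice_differentiable_at_def by blast
  then show ?thesis unfolding twice_differentiable_at_def
    by (intro exI[of _ "\<lambda>y h. L (f' y h)"] exI[of _ "\<lambda>h w. L (f'' h w)"])
      (auto intro!: bounded_linear.has_derivative[OF L])
qed

lemma twice_differentiable_at_inner_const:
  "twice_differentiable_at (\<lambda>y. c \<bullet> y) a"
  unfolding twice_differentiable_at_def
  by (intro exI[of _ "\<lambda>y h. c \<bullet> h"] exI[of _ "\<lambda>h w. 0"]) (auto intro!: derivative_eq_intros)

lemma twice_differentiable_at_const:
  "twice_differentiable_at (\<lambda>y. c) a"
  unfolding twice_differentiable_at_def
  by (intro exI[of _ "\<lambda>y h. 0"] exI[of _ "\<lambda>h w. 0"]) auto

text \<open>Here \<open>r\<close> stands for the term \<open>lam k \<bullet> x\<close>, linear in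
  the state and constant in the control, so that one rule serves both Hessian blocks.\<close>

lemma twice_differentiable_at_lagrangian:
  assumes g: "twice_differentiable_at g a" and f: "twice_differentiable_at f a"
    and r: "twice_differentiable_at r a"
  shows "twice_differentiable_at (\<lambda>v. g v + r v - c \<bullet> f v) a"
proof -
  have "twice_differentiable_at (\<lambda>v. (g v + r v) + (- c) \<bullet> f v) a"
    by (intro twice_differentiable_at_add g r twice_differentiable_at_bounded_linear[OF f]
        bounded_linear_inner_right)
  then show ?thesis by simp
qed

lemma transpose_Qm_Rm_lq_of_ocp:
  fixes P :: "('x::finite, 'u::finite, 'd::finite) ocp"
  assumes sm: "smooth_ocp N P" and D: "D = lq_of_ocp N P d x u lam"
  shows "k \<le> N \<Longrightarrow> transpose (Qm D k) = Qm D k" "k < N \<Longrightarrow> transpose (Rm D k) = Rm D k"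
proof -
  have x: "twice_differentiable_at (\<lambda>v. F (v, b, c)) a"
    if "twice_continuously_differentiable F" for F :: "_ \<Rightarrow> 'z::real_normed_vector"
      and a :: "real^'a" and b :: "real^'b" and c :: "real^'c"
    using twice_differentiable_at_affine[OF that, of "\<lambda>v. (v, 0, 0)" "(0, b, c)" a]
    by (simp add: bounded_linear_Pair)
  have u: "twice_differentiable_at (\<lambda>v. F (b, v, c)) a"
    if "twice_continuously_differentiable F" for F :: "_ \<Rightarrow> 'z::real_normed_vector"
      and a :: "real^'a" and b :: "real^'b" and c :: "real^'c"
    using twice_differentiable_at_affine[OF that, of "\<lambda>v. (0, v, 0)" "(b, 0, c)" a]
    by (simp add: bounded_linear_Pair)
  have xN: "twice_differentiable_at (\<lambda>v. F (v, c)) a"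
    if "twice_continuously_differentiable F" for F :: "_ \<Rightarrow> 'z::real_normed_vector"
      and a :: "real^'a" and c :: "real^'c"
    using twice_differentiable_at_affine[OF that, of "\<lambda>v. (v, 0)" "(0, c)" a]
    by (simp add: bounded_linear_Pair)
  have g: "twice_continuously_differentiable (\<lambda>(x, u, d). stage_cost P k x u d)"
    and f: "twice_continuously_differentiable (\<lambda>(x, u, d). dyn P k x u d)" if "k < N" for k
    using sm that unfolding smooth_ocp_def by auto
  have gN: "twice_continuously_differentiable (\<lambda>(x, d). final_cost P x d)"
    using sm unfolding smooth_ocp_def by auto
  show "transpose (Qm D k) = Qm D k" if "k \<le> N"
  proof (cases "k < N")
    case True
    have "twice_differentiable_at (\<lambda>v. stage_lagrangian P lam k v (u k) (d k)) (x k)"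
      unfolding stage_lagrangian_def
      using x[OF g[OF True]] x[OF f[OF True]]
      by (intro twice_differentiable_at_lagrangian twice_differentiable_at_inner_const) auto
    with True show ?thesis by (simp add: D lq_of_ocp_def transpose_hessian)
  next
    case False
    have "twice_differentiable_at (\<lambda>v. final_lagrangian N P lam v (d N)) (x N)"
      unfolding final_lagrangian_def
      using xN[OF gN] by (intro twice_differentiable_at_add twice_differentiable_at_inner_const) auto
    with False show ?thesis by (simp add: D lq_of_ocp_def transpose_hessian)
  qed
  show "transpose (Rm D k) = Rm D k" if "k < N"
  proof -
    have "twice_differentiable_at (\<lambda>v. stage_lagrangian P lam k (x k) v (d k)) (u k)"
      unfolding stage_lagrangian_def
      using u[OF g[OF that]] u[OF f[OF that]]
      by (intro twice_differentiable_at_lagrangian twice_differentiable_at_const) auto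
    with that show ?thesis by (simp add: D lq_of_ocp_def transpose_hessian)
  qed
qed

subsection \<open>Matrix algebra\<close>

lemma transpose_add: "transpose (A + B) = transpose A + transpose (B :: real^'n^'m)"
  and transpose_diff: "transpose (A - B) = transpose A - transpose B"
  and transpose_minus: "transpose (- A) = - transpose A"
  by (simp_all add: transpose_def vec_eq_iff)

lemma minus_matrix_vector_mult: "(- A) *v x = - (A *v (x :: real^'n))"
  using matrix_vector_mult_diff_rdistrib[of 0 A x] by simp

lemma matrix_vector_mult_minus: "A *v (- x) = - (A *v (x :: real^'n))"
  using matrix_vector_mult_diff_distrib[of A 0 x] by simp

lemma mat_matrix_vector_mult: "mat c *v x = c *\<^sub>R (x :: real^'n)"
  by (simp add: vec_eq_iff matrix_vector_mult_def mat_def if_distrib[of "\<lambda>t. t * _"] cong: if_cong)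

lemma inner_transpose: "x \<bullet> (transpose A *v y) = (A *v x) \<bullet> (y :: real^'n)"
  by (metis dot_lmul_matrix inner_commute transpose_matrix_vector)

lemma matrix_inv_works:
  fixes A :: "real^'n^'n"
  assumes "invertible A"
  shows matrix_inv_left: "matrix_inv A ** A = mat 1" and matrix_inv_right: "A ** matrix_inv A = mat 1"
proof -
  have "A ** matrix_inv A = mat 1 \<and> matrix_inv A ** A = mat 1"
    unfolding matrix_inv_def using assms unfolding invertible_def by (rule someI_ex)
  then show "matrix_inv A ** A = mat 1" "A ** matrix_inv A = mat 1" by auto
qed

text \<open>Transposing \<open>A ** matrix_inv A = mat 1\<close> makes the transpose a left inverse
  of \<open>A\<close>, and a left inverse equals a right inverse.\<close>

lemma transpose_matrix_inv:
  fixes A :: "real^'n^'n"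
  assumes "invertible A" "transpose A = A"
  shows "transpose (matrix_inv A) = matrix_inv A"
proof -
  have "transpose (matrix_inv A) ** A = mat 1"
    by (metis assms matrix_inv_right matrix_transpose_mul transpose_mat)
  then show ?thesis
    by (metis assms(1) matrix_inv_right matrix_mul_assoc matrix_mul_lid matrix_mul_rid)
qed

text \<open>Turns matrix products acting on a vector into iterated actions and distributes them, so
  that matrix identities become linear arithmetic of vectors.\<close>

lemmas matrix_vector_expand =
  matrix_vector_mul_assoc[symmetric] matrix_vector_mult_add_rdistrib matrix_vector_mult_diff_rdistrib
  minus_matrix_vector_mult matrix_vector_right_distrib matrix_vector_mult_diff_distrib
  matrix_vector_mult_minus matrix_vector_mult_scaleR

lemmas transpose_expand = transpose_add transpose_diff transpose_minus matrix_transpose_mul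

subsection \<open>The reduced quadratic form\<close>

text \<open>The condition \<gamma> I \<le> ReH without a basis: coercivity of the homogeneous cost
  on trajectories that start at 0. All later arguments use this form instead of
  \<open>Z\<close>.\<close>

definition reduced_coercive :: "nat \<Rightarrow> ('x::finite, 'u::finite, 'd::finite) lq \<Rightarrow> real \<Rightarrow> bool" where
  "reduced_coercive N D \<gamma> \<longleftrightarrow>
    (\<forall>p q. lqp_feasible N D 0 (\<lambda>_. 0) p q \<longrightarrow>
      \<gamma> * ((\<Sum>k\<le>N. p k \<bullet> p k) + (\<Sum>k<N. q k \<bullet> q k)) \<le> lqp_cost N D (\<lambda>_. 0) p q)"

lemma lqp_cost_zero_direction:
  "lqp_cost N D (\<lambda>_. 0) p q =
    (\<Sum>k<N. p k \<bullet> (Qm D k *v p k + transpose (Sm D k) *v q k) + q k \<bullet> (Sm D k *v p k + Rm D k *v q k))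
    + p N \<bullet> (Qm D N *v p N)"
  unfolding lqp_cost_def by simp

section \<open>Trajectories as coordinate vectors in the kernel of G\<close>

lemma sum_z_coords:
  fixes g :: "('x::finite, 'u::finite) coord \<Rightarrow> real"
  shows "(\<Sum>c\<in>z_coords N. g c) =
    (\<Sum>k\<le>N. \<Sum>i\<in>UNIV. g (Inl (k, i))) + (\<Sum>k<N. \<Sum>i\<in>UNIV. g (Inr (k, i)))"
  unfolding z_coords_def by (subst sum.Plus) (auto simp: sum.cartesian_product)

definition z_of :: "(nat \<Rightarrow> real^'x) \<Rightarrow> (nat \<Rightarrow> real^'u) \<Rightarrow> ('x, 'u) coord \<Rightarrow> real" where
  "z_of p q = case_sum (\<lambda>(k, i). p k $ i) (\<lambda>(k, i). q k $ i)"

lemma z_of_simps [simp]: "z_of p q (Inl (k, i)) = p k $ i" "z_of p q (Inr (k, j)) = q k $ j"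
  by (simp_all add: z_of_def)

lemma sum_if_mult_delta:
  fixes X :: "nat \<Rightarrow> 'i \<Rightarrow> real"
  assumes "finite K"
  shows "(\<Sum>k'\<in>K. \<Sum>j\<in>J. (if k = k' then X k' j else 0) * y k' j) =
    (if k \<in> K then (\<Sum>j\<in>J. X k j * y k j) else 0)"
proof -
  have "(\<Sum>k'\<in>K. \<Sum>j\<in>J. (if k = k' then X k' j else 0) * y k' j) =
      (\<Sum>k'\<in>K. if k = k' then (\<Sum>j\<in>J. X k' j * y k' j) else 0)"
    by (intro sum.cong) auto
  with assms show ?thesis by simp
qed

text \<open>Stage \<open>N\<close> has no control coordinate, so the coupling with \<open>Sm\<close>
  occurs only for \<open>k < N\<close>.\<close>

lemma full_hessian_rows:
  fixes D :: "('x::finite, 'u::finite, 'd::finite) lq"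
  shows "k \<le> N \<Longrightarrow> (\<Sum>b\<in>z_coords N. full_hessian D (Inl (k, i)) b * z_of p q b) =
      (Qm D k *v p k + (if k < N then transpose (Sm D k) *v q k else 0)) $ i"
    and "k < N \<Longrightarrow> (\<Sum>b\<in>z_coords N. full_hessian D (Inr (k, j)) b * z_of p q b) =
      (Sm D k *v p k + Rm D k *v q k) $ j"
  by (simp_all add: sum_z_coords sum_if_mult_delta matrix_vector_mult_def)

lemma lqp_cost_eq_full_hessian:
  fixes D :: "('x::finite, 'u::finite, 'd::finite) lq"
  shows "(\<Sum>a\<in>z_coords N. \<Sum>b\<in>z_coords N. z_of p q a * full_hessian D a b * z_of p q b) =
    lqp_cost N D (\<lambda>_. 0) p q"
proof -
  have "(\<Sum>a\<in>z_coords N. \<Sum>b\<in>z_coords N. z_of p q a * full_hessian D a b * z_of p q b) =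
     (\<Sum>a\<in>z_coords N. z_of p q a * (\<Sum>b\<in>z_coords N. full_hessian D a b * z_of p q b))"
    by (simp add: sum_distrib_left mult.assoc)
  also have "\<dots> = (\<Sum>k\<le>N. p k \<bullet> (Qm D k *v p k + (if k < N then transpose (Sm D k) *v q k else 0)))
      + (\<Sum>k<N. q k \<bullet> (Sm D k *v p k + Rm D k *v q k))"
    by (subst sum_z_coords) (simp add: full_hessian_rows inner_vec_def)
  also have "\<dots> = lqp_cost N D (\<lambda>_. 0) p q"
    by (simp add: lqp_cost_zero_direction lessThan_Suc_atMost[symmetric] sum.distrib)
  finally show ?thesis .
qed

lemma z_of_in_constraint_kernel:
  fixes D :: "('x::finite, 'u::finite, 'd::finite) lq"
  assumes "lqp_feasible N D 0 (\<lambda>_. 0) p q"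
  shows "z_of p q \<in> constraint_kernel N D"
  unfolding constraint_kernel_def constraint_rows_def
proof safe
  fix r :: nat and i :: 'x
  assume r: "r \<le> N"
  have p0: "p 0 = 0" and pS: "\<And>k. k < N \<Longrightarrow> p (Suc k) = Am D k *v p k + Bm D k *v q k"
    using assms by (auto simp: lqp_feasible_def)
  have id: "(\<Sum>k\<le>N. \<Sum>j\<in>UNIV. (if k = r \<and> j = i then 1 else 0) * p k $ j) = p r $ i"
  proof -
    have "(\<Sum>k\<le>N. \<Sum>j\<in>UNIV. (if k = r \<and> j = i then 1 else 0) * p k $ j) =
       (\<Sum>k\<le>N. if k = r then p k $ i else 0)"
      by (intro sum.cong) (auto simp: if_distrib[of "\<lambda>t. t * _"] cong: if_cong)
    with r show ?thesis by simp
  qed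
  \<comment> \<open>Row 0 is the initial condition and meets no dynamics block; row
    \<open>Suc k\<close> picks out stage \<open>k\<close>.\<close>
  have A: "(\<Sum>k\<le>N. \<Sum>j\<in>UNIV. (if r = Suc k then Am D k $ i $ j else 0) * p k $ j)
      = (case r of 0 \<Rightarrow> 0 | Suc k \<Rightarrow> (Am D k *v p k) $ i)"
    using r by (cases r) (auto simp: sum_if_mult_delta matrix_vector_mult_def)
  have B: "(\<Sum>k<N. \<Sum>j\<in>UNIV. (if r = Suc k then Bm D k $ i $ j else 0) * q k $ j)
      = (case r of 0 \<Rightarrow> 0 | Suc k \<Rightarrow> (Bm D k *v q k) $ i)"
    using r by (cases r) (auto simp: sum_if_mult_delta matrix_vector_mult_def)
  have "(\<Sum>c\<in>z_coords N. constraint_jacobian D (r, i) c * z_of p q c) =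
      p r $ i - (case r of 0 \<Rightarrow> 0 | Suc k \<Rightarrow> (Am D k *v p k) $ i)
       - (case r of 0 \<Rightarrow> 0 | Suc k \<Rightarrow> (Bm D k *v q k) $ i)"
    unfolding sum_z_coords constraint_jacobian.simps z_of_simps left_diff_distrib minus_mult_left[symmetric]
      sum_subtractf sum_negf id A B by simp
  also have "\<dots> = 0" using r p0 pS by (cases r) auto
  finally show "(\<Sum>c\<in>z_coords N. constraint_jacobian D (r, i) c * z_of p q c) = 0" .
qed

text \<open>A trajectory has coefficients \<open>a\<close> in the columns of \<open>Z\<close>.
  Orthonormality makes its squared norm the sum of the squares of \<open>a\<close>, and its cost is
  the quadratic form of ReH at \<open>a\<close>.\<close>

lemma reduced_coercive_of_reduced_hessian:
  fixes D :: "('x::finite, 'u::finite, 'd::finite) lq"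
  assumes basis: "orthonormal_kernel_basis N D m Z"
    and pos: "succeq_scaled_id m (reduced_hessian N D Z) \<gamma>"
  shows "reduced_coercive N D \<gamma>"
  unfolding reduced_coercive_def
proof (intro allI impI)
  fix p q assume "lqp_feasible N D 0 (\<lambda>_. 0) p q"
  then have "z_of p q \<in> constraint_kernel N D" by (rule z_of_in_constraint_kernel)
  with basis obtain a where a: "\<And>c. c \<in> z_coords N \<Longrightarrow> z_of p q c = (\<Sum>j<m. Z c j * a j)"
    and on: "\<And>i j. i < m \<Longrightarrow> j < m \<Longrightarrow> (\<Sum>c\<in>z_coords N. Z c i * Z c j) = (if i = j then 1 else 0)"
    unfolding orthonormal_kernel_basis_def by blast
  have "(\<Sum>k\<le>N. p k \<bullet> p k) + (\<Sum>k<N. q k \<bullet> q k) = (\<Sum>c\<in>z_coords N. z_of p q c * z_of p q c)"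
    by (simp add: sum_z_coords inner_vec_def)
  also have "\<dots> = (\<Sum>c\<in>z_coords N. \<Sum>i<m. \<Sum>j<m. a i * a j * (Z c i * Z c j))"
    by (rule sum.cong) (simp_all add: a sum_product algebra_simps)
  also have "\<dots> = (\<Sum>i<m. \<Sum>j<m. \<Sum>c\<in>z_coords N. a i * a j * (Z c i * Z c j))"
    by (subst sum.swap, rule sum.cong[OF refl], rule sum.swap)
  also have "\<dots> = (\<Sum>i<m. \<Sum>j<m. a i * a j * (if i = j then 1 else 0))"
    by (intro sum.cong refl) (simp add: sum_distrib_left[symmetric] on del: mult_cancel_left1)
  also have "\<dots> = (\<Sum>i<m. (a i)\<^sup>2)"
    by (simp add: power2_eq_square if_distrib[of "\<lambda>t. _ * t"] cong: if_cong)
  finally have n: "(\<Sum>k\<le>N. p k \<bullet> p k) + (\<Sum>k<N. q k \<bullet> q k) = (\<Sum>i<m. (a i)\<^sup>2)" .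
  let ?t = "\<lambda>c b i j. a i * (Z c i * full_hessian D c b * Z b j) * a j"
  have "lqp_cost N D (\<lambda>_. 0) p q =
      (\<Sum>c\<in>z_coords N. \<Sum>b\<in>z_coords N. z_of p q c * full_hessian D c b * z_of p q b)"
    by (rule lqp_cost_eq_full_hessian[symmetric])
  also have "\<dots> = (\<Sum>c\<in>z_coords N. \<Sum>b\<in>z_coords N. \<Sum>i<m. \<Sum>j<m. ?t c b i j)"
    by (intro sum.cong refl) (simp add: a sum_distrib_left sum_distrib_right algebra_simps)
  also have "\<dots> = (\<Sum>i<m. \<Sum>j<m. \<Sum>c\<in>z_coords N. \<Sum>b\<in>z_coords N. ?t c b i j)"
  proof -
    have "(\<Sum>b\<in>z_coords N. \<Sum>i<m. \<Sum>j<m. ?t c b i j) = (\<Sum>i<m. \<Sum>j<m. \<Sum>b\<in>z_coords N. ?t c b i j)" for c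
      by (subst sum.swap, rule sum.cong[OF refl], rule sum.swap)
    then have "(\<Sum>c\<in>z_coords N. \<Sum>b\<in>z_coords N. \<Sum>i<m. \<Sum>j<m. ?t c b i j) =
        (\<Sum>c\<in>z_coords N. \<Sum>i<m. \<Sum>j<m. \<Sum>b\<in>z_coords N. ?t c b i j)" by simp
    also have "\<dots> = (\<Sum>i<m. \<Sum>j<m. \<Sum>c\<in>z_coords N. \<Sum>b\<in>z_coords N. ?t c b i j)"
      by (subst sum.swap, rule sum.cong[OF refl], rule sum.swap)
    finally show ?thesis .
  qed
  also have "\<dots> = (\<Sum>i<m. \<Sum>j<m. a i * reduced_hessian N D Z i j * a j)"
    unfolding reduced_hessian_def by (simp only: sum_distrib_left sum_distrib_right)
  finally show "\<gamma> * ((\<Sum>k\<le>N. p k \<bullet> p k) + (\<Sum>k<N. q k \<bullet> q k)) \<le> lqp_cost N D (\<lambda>_. 0) p q"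
    using pos unfolding succeq_scaled_id_def n by simp
qed

subsection \<open>The Riccati recursion\<close>

text \<open>The off-diagonal blocks of \<open>H\<^sub>k\<close> are \<open>Sm\<close> and its
  transpose by construction, so symmetry of \<open>H\<^sub>k\<close> comes down to the diagonal
  blocks.\<close>

definition symmetric_lq :: "nat \<Rightarrow> ('x::finite, 'u::finite, 'd::finite) lq \<Rightarrow> bool" where
  "symmetric_lq N D \<longleftrightarrow>
    (\<forall>k\<le>N. transpose (Qm D k) = Qm D k) \<and> (\<forall>k<N. transpose (Rm D k) = Rm D k)"

text \<open>The bracket that \<open>Kr\<close> and \<open>Pr\<close> share.\<close>

definition Fr :: "nat \<Rightarrow> ('x::finite, 'u::finite, 'd::finite) lq \<Rightarrow> nat \<Rightarrow> real^'x^'u" where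
  "Fr N D k = transpose (Bm D k) ** Kr N D (Suc k) ** Am D k + Sm D k"

lemma Kr_final: "Kr N D N = Qm D N"
  by (subst Kr.simps) simp

lemma Kr_step:
  "k < N \<Longrightarrow> Kr N D k =
    Qm D k + transpose (Am D k) ** Kr N D (Suc k) ** Am D k
    - transpose (Fr N D k) ** matrix_inv (Wr N D k) ** Fr N D k"
  by (subst Kr.simps) (simp add: Let_def Wr_def Fr_def)

lemma Pr_Fr: "Pr N D k = - (matrix_inv (Wr N D k) ** Fr N D k)"
  by (simp add: Pr_def Fr_def)

text \<open>Absorbing \<open>- W\<^sub>k\<^sup>-\<^sup>1 F\<^sub>k\<close> into the feedback matrix
  removes the inverse from the Riccati step.\<close>

lemma Kr_step_Pr:
  "k < N \<Longrightarrow> Kr N D k *v v =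
    Qm D k *v v + transpose (Am D k) *v (Kr N D (Suc k) *v (Am D k *v v))
    + transpose (Fr N D k) *v (Pr N D k *v v)"
  by (simp add: Kr_step Pr_Fr matrix_vector_expand)

lemma transpose_Wr:
  assumes "symmetric_lq N D" "k < N" "transpose (Kr N D (Suc k)) = Kr N D (Suc k)"
  shows "transpose (Wr N D k) = Wr N D k"
  using assms by (simp add: Wr_def symmetric_lq_def transpose_expand matrix_mul_assoc)

lemma transpose_Kr_step:
  assumes "symmetric_lq N D" "k < N" "transpose (Kr N D (Suc k)) = Kr N D (Suc k)"
    and "invertible (Wr N D k)"
  shows "transpose (Kr N D k) = Kr N D k"
proof -
  have "transpose (matrix_inv (Wr N D k)) = matrix_inv (Wr N D k)"
    using assms by (intro transpose_matrix_inv transpose_Wr)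
  with assms show ?thesis
    by (simp add: Kr_step symmetric_lq_def transpose_expand matrix_mul_assoc)
qed

text \<open>Invertibility is asked only from stage \<open>k\<close> on, so that the lemma can be
  used inside the backward induction that establishes invertibility.\<close>

lemma transpose_Kr:
  assumes "symmetric_lq N D" "\<And>i. k \<le> i \<Longrightarrow> i < N \<Longrightarrow> invertible (Wr N D i)" "k \<le> N"
  shows "transpose (Kr N D k) = Kr N D k"
  using assms(3,2)
proof (induction k rule: inc_induct)
  case base
  then show ?case using assms(1) by (simp add: Kr_final symmetric_lq_def)
next
  case (step n)
  show ?case by (rule transpose_Kr_step[OF assms(1)]) (use step in auto)
qed

lemma Wr_Pr: "invertible (Wr N D k) \<Longrightarrow> Wr N D k *v (Pr N D k *v v) = - (Fr N D k *v v)"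
proof -
  assume "invertible (Wr N D k)"
  then have "Wr N D k *v (matrix_inv (Wr N D k) *v w) = w" for w
    by (simp add: matrix_vector_mul_assoc matrix_inv_right)
  then show ?thesis
    by (simp add: Pr_Fr matrix_vector_expand)
qed

text \<open>The Bellman identity: stage cost plus cost-to-go of the successor is the cost-to-go of
  \<open>p\<close>. The total is quadratic in \<open>q\<close> with leading matrix
  \<open>W\<^sub>k\<close> and cross term \<open>2 q \<bullet> F\<^sub>k p\<close>; for feedback the
  leading term cancels half of the cross term.\<close>

lemma feedback_stage_cost:
  assumes k: "k < N" and W: "invertible (Wr N D k)"
    and K: "transpose (Kr N D (Suc k)) = Kr N D (Suc k)"
    and q: "q = Pr N D k *v p"
  shows "p \<bullet> (Qm D k *v p + transpose (Sm D k) *v q) + q \<bullet> (Sm D k *v p + Rm D k *v q)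
      + (Am D k *v p + Bm D k *v q) \<bullet> (Kr N D (Suc k) *v (Am D k *v p + Bm D k *v q))
    = p \<bullet> (Kr N D k *v p)"
proof -
  let ?K = "Kr N D (Suc k)" and ?a = "Am D k *v p" and ?b = "Bm D k *v q"
  have "q \<bullet> (Wr N D k *v q) = - (q \<bullet> (Fr N D k *v p))"
    using Wr_Pr[OF W] by (simp add: q)
  moreover have "q \<bullet> (Wr N D k *v q) = q \<bullet> (Rm D k *v q) + ?b \<bullet> (?K *v ?b)"
    by (simp add: Wr_def matrix_vector_expand inner_transpose inner_add_right)
  moreover have "q \<bullet> (Fr N D k *v p) = ?b \<bullet> (?K *v ?a) + q \<bullet> (Sm D k *v p)"
    by (simp add: Fr_def matrix_vector_expand inner_transpose inner_add_right)
  moreover have "p \<bullet> (Kr N D k *v p) = p \<bullet> (Qm D k *v p) + ?a \<bullet> (?K *v ?a) + (Fr N D k *v p) \<bullet> q"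
    by (simp add: Kr_step_Pr[OF k] q[symmetric] inner_transpose inner_add_right)
  moreover have "?a \<bullet> (?K *v ?b) = ?b \<bullet> (?K *v ?a)"
    using K inner_transpose[of ?a ?K ?b] by (simp add: inner_commute)
  ultimately show ?thesis
    by (simp add: matrix_vector_expand inner_transpose inner_add_right inner_add_left
        inner_commute[of "Fr N D k *v p" q] inner_commute[of "Sm D k *v p" q])
qed

section \<open>Positivity and invertibility of the matrices \<open>W\<^sub>k\<close>\<close>

lemma invertible_if_positive:
  fixes W :: "real^'n^'n"
  assumes "\<And>v. v \<noteq> 0 \<Longrightarrow> v \<bullet> (W *v v) > 0"
  shows "invertible W"
  unfolding invertible_left_inverse matrix_left_invertible_ker
  using assms by (metis inner_zero_right less_irrefl)

text \<open>The test trajectory rests until stage \<open>k\<close>, applies the control \<open>v\<close> there and follows the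
  feedback \<open>q = P p\<close> afterwards, so that its cost is exactly \<open>v \<bullet> (W\<^sub>k *v v)\<close>.\<close>

lemma reduced_coercive_Wr:
  fixes D :: "('x::finite, 'u::finite, 'd::finite) lq"
  assumes co: "reduced_coercive N D \<gamma>" and \<gamma>: "\<gamma> > 0" and k: "k < N"
    and W: "\<And>i. Suc k \<le> i \<Longrightarrow> i < N \<Longrightarrow> invertible (Wr N D i)"
    and K: "\<And>i. Suc k \<le> i \<Longrightarrow> i \<le> N \<Longrightarrow> transpose (Kr N D i) = Kr N D i"
    and v: "v \<noteq> 0"
  shows "v \<bullet> (Wr N D k *v v) > 0"
proof -
  define p where "p = rec_nat (0 :: real^'x) (\<lambda>n pn. if n < k then 0 else if n = k then Bm D k *v v else Er N D n *v pn)"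
  define q where "q = (\<lambda>n. if n < k then 0 else if n = k then v else Pr N D n *v p n)"
  have p0: "p 0 = 0" and pS: "\<And>n. p (Suc n) = (if n < k then 0 else if n = k then Bm D k *v v else Er N D n *v p n)"
    by (simp_all add: p_def)
  have pk: "n \<le> k \<Longrightarrow> p n = 0" for n
    using p0 pS by (cases n) auto
  have dyn: "p (Suc n) = Am D n *v p n + Bm D n *v q n" for n
    by (cases "n \<le> k") (auto simp: pk pS q_def Er_def matrix_vector_expand)
  then have feas: "lqp_feasible N D 0 (\<lambda>_. 0) p q"
    using p0 by (simp add: lqp_feasible_def)
  define c where "c = (\<lambda>n. p n \<bullet> (Qm D n *v p n + transpose (Sm D n) *v q n) + q n \<bullet> (Sm D n *v p n + Rm D n *v q n))"
  \<comment> \<open>From stage \<open>Suc k\<close> on the trajectory is pure feedback, so the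
    Bellman identity telescopes backwards from the final cost, where
    \<open>K\<^sub>N = Q\<^sub>N\<close>.\<close>
  have tail: "(\<Sum>i=n..<N. c i) + p N \<bullet> (Qm D N *v p N) = p n \<bullet> (Kr N D n *v p n)" if "n \<le> N" "Suc k \<le> n" for n
    using that
  proof (induction n rule: inc_induct)
    case base
    then show ?case by (simp add: Kr_final)
  next
    case (step n)
    have "c n + p (Suc n) \<bullet> (Kr N D (Suc n) *v p (Suc n)) = p n \<bullet> (Kr N D n *v p n)"
      unfolding c_def dyn using step.hyps step.prems
      by (intro feedback_stage_cost W K) (auto simp: q_def)
    then show ?case using step by (simp add: sum.atLeast_Suc_lessThan)
  qed
  have "(\<Sum>i<N. c i) = (\<Sum>i<k. c i) + (\<Sum>i=k..<N. c i)"
    using k sum.atLeastLessThan_concat[of 0 k N c] by (simp add: atLeast0LessThan)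
  also have "(\<Sum>i<k. c i) = 0"
    using pk by (intro sum.neutral) (auto simp: c_def q_def)
  also have "(\<Sum>i=k..<N. c i) = v \<bullet> (Rm D k *v v) + (\<Sum>i=Suc k..<N. c i)"
    using k pk[of k] by (simp add: sum.atLeast_Suc_lessThan c_def q_def)
  finally have "lqp_cost N D (\<lambda>_. 0) p q = v \<bullet> (Rm D k *v v) + p (Suc k) \<bullet> (Kr N D (Suc k) *v p (Suc k))"
    using tail[of "Suc k"] k unfolding lqp_cost_zero_direction c_def by simp
  \<comment> \<open>The state leaves rest as \<open>p (Suc k) = Bm D k *v v\<close>, so the
    cost-to-go supplies the second summand of \<open>W\<^sub>k\<close>.\<close>
  also have "\<dots> = v \<bullet> (Wr N D k *v v)"
    by (simp add: pS Wr_def matrix_vector_expand inner_transpose inner_add_right)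
  finally have cost: "lqp_cost N D (\<lambda>_. 0) p q = v \<bullet> (Wr N D k *v v)" .
  \<comment> \<open>The single control \<open>q k = v\<close> already makes the norm of the
    trajectory positive.\<close>
  have "q k \<bullet> q k \<le> (\<Sum>i<N. q i \<bullet> q i)"
    using k by (intro member_le_sum) auto
  moreover have "0 \<le> (\<Sum>i\<le>N. p i \<bullet> p i)" by (intro sum_nonneg) auto
  moreover have "q k \<bullet> q k > 0" using v by (simp add: q_def)
  ultimately have "0 < \<gamma> * ((\<Sum>i\<le>N. p i \<bullet> p i) + (\<Sum>i<N. q i \<bullet> q i))"
    using \<gamma> by (intro mult_pos_pos) linarith+
  also have "\<dots> \<le> lqp_cost N D (\<lambda>_. 0) p q"
    using co feas unfolding reduced_coercive_def by blast
  finally show ?thesis using cost by simp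
qed

text \<open>Backward induction that keeps invertibility at all stages from \<open>k\<close> on: the
  test trajectory for stage \<open>n\<close> uses the feedback, and the symmetry of
  \<open>K\<^sub>i\<close>, at every later stage.\<close>

lemma reduced_coercive_invertible_Wr:
  assumes sym: "symmetric_lq N D" and co: "reduced_coercive N D \<gamma>" and \<gamma>: "\<gamma> > 0" and "k < N"
  shows "invertible (Wr N D k)"
proof -
  have "\<forall>i\<ge>k. i < N \<longrightarrow> invertible (Wr N D i)" if "k \<le> N" for k
    using that
  proof (induction k rule: inc_induct)
    case base
    then show ?case by simp
  next
    case (step n)
    have W: "invertible (Wr N D i)" if "Suc n \<le> i" "i < N" for i
      using step that by auto
    have K: "transpose (Kr N D i) = Kr N D i" if "Suc n \<le> i" "i \<le> N" for i
      using that by (intro transpose_Kr[OF sym] W) auto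
    have "invertible (Wr N D n)"
      using reduced_coercive_Wr[OF co \<gamma> step.hyps(2) W K] by (rule invertible_if_positive)
    then show ?case using step by (metis Suc_leI le_neq_implies_less)
  qed
  with \<open>k < N\<close> show ?thesis by auto
qed

subsection \<open>Convexification\<close>

text \<open>Lowering each \<open>Q\<^sub>k\<close> costs exactly \<beta> times the squared norm of
  the states; since \<beta> is nonnegative, this is at most \<beta> times the squared norm of the
  whole trajectory.\<close>

lemma reduced_coercive_shift:
  fixes D :: "('x::finite, 'u::finite, 'd::finite) lq"
  assumes co: "reduced_coercive N D \<gamma>" and \<beta>: "0 \<le> \<beta>"
  shows "reduced_coercive N (D\<lparr>Qm := \<lambda>k. Qm D k - mat \<beta>\<rparr>) (\<gamma> - \<beta>)"
  unfolding reduced_coercive_def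
proof (intro allI impI)
  let ?D = "D\<lparr>Qm := \<lambda>k. Qm D k - mat \<beta>\<rparr>"
  fix p q assume "lqp_feasible N ?D 0 (\<lambda>_. 0) p q"
  then have "lqp_feasible N D 0 (\<lambda>_. 0) p q" by (simp add: lqp_feasible_def)
  then have "\<gamma> * ((\<Sum>k\<le>N. p k \<bullet> p k) + (\<Sum>k<N. q k \<bullet> q k)) \<le> lqp_cost N D (\<lambda>_. 0) p q"
    using co unfolding reduced_coercive_def by blast
  moreover have "lqp_cost N ?D (\<lambda>_. 0) p q = lqp_cost N D (\<lambda>_. 0) p q - \<beta> * (\<Sum>k\<le>N. p k \<bullet> p k)"
    unfolding lqp_cost_zero_direction
    by (simp add: matrix_vector_expand mat_matrix_vector_mult lessThan_Suc_atMost[symmetric] inner_diff_right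
        inner_add_right sum.distrib sum_subtractf sum_distrib_left algebra_simps)
  moreover have "0 \<le> \<beta> * (\<Sum>k<N. q k \<bullet> q k)" using \<beta> by (simp add: sum_nonneg)
  ultimately show "(\<gamma> - \<beta>) * ((\<Sum>k\<le>N. p k \<bullet> p k) + (\<Sum>k<N. q k \<bullet> q k)) \<le> lqp_cost N ?D (\<lambda>_. 0) p q"
    by (simp add: algebra_simps)
qed

text \<open>Since \<open>Q_tilde\<close> is the Riccati correction plus \<open>\<beta> I\<close>, the recursion for \<open>Q_bar\<close> is the Riccati
  recursion of the problem with every \<open>Q\<^sub>k\<close> lowered by \<open>\<beta> I\<close>, and \<open>R_tilde\<close> is its \<open>W\<^sub>k\<close>.\<close>

lemma Q_bar_final: "Q_bar N \<beta> D N = Qm D N - mat \<beta>"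
  by (subst Q_bar.simps) simp

lemma Q_bar_eq_Kr:
  assumes "k \<le> N"
  shows "Q_bar N \<beta> D k = Kr N (D\<lparr>Qm := \<lambda>k. Qm D k - mat \<beta>\<rparr>) k"
  using assms
proof (induction k rule: inc_induct)
  case base
  then show ?case by (simp add: Kr_final Q_bar_final)
next
  case (step n)
  then show ?case
    by (subst Q_bar.simps)
      (simp add: Kr_step Q_hat_def Q_tilde_def R_tilde_def S_tilde_def Wr_def Fr_def add.commute)
qed

lemma R_tilde_eq_Wr:
  "k < N \<Longrightarrow> R_tilde D k (Q_bar N \<beta> D (Suc k)) = Wr N (D\<lparr>Qm := \<lambda>k. Qm D k - mat \<beta>\<rparr>) k"
  by (simp add: R_tilde_def Wr_def Q_bar_eq_Kr)

lemma symmetric_lq_shift: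
  "symmetric_lq N D \<Longrightarrow> symmetric_lq N (D\<lparr>Qm := \<lambda>k. Qm D k - mat \<beta>\<rparr>)"
  by (simp add: symmetric_lq_def transpose_expand)

text \<open>\<open>R_tilde\<close> is the matrix \<open>W\<^sub>k\<close> of the shifted problem,
  which is coercive with constant \<open>\<gamma> - \<beta> > 0\<close>. It is therefore symmetric
  and invertible, and its inverse inside \<open>Q_tilde\<close> is symmetric too.\<close>

lemma symmetric_lq_convexify:
  assumes sym: "symmetric_lq N D" and co: "reduced_coercive N D \<gamma>" and \<beta>: "0 < \<beta>" "\<beta> < \<gamma>"
  shows "symmetric_lq N (convexify N \<beta> D)"
proof -
  let ?D = "D\<lparr>Qm := \<lambda>k. Qm D k - mat \<beta>\<rparr>"
  have W: "invertible (Wr N ?D k)" if "k < N" for k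
    using reduced_coercive_invertible_Wr[OF symmetric_lq_shift[OF sym] reduced_coercive_shift[OF co]] \<beta> that
    by simp
  have K: "transpose (Kr N ?D k) = Kr N ?D k" if "k \<le> N" for k
    using that by (intro transpose_Kr symmetric_lq_shift[OF sym] W)
  have "transpose (R_tilde D k (Q_bar N \<beta> D (Suc k))) = R_tilde D k (Q_bar N \<beta> D (Suc k))" if "k < N" for k
    using that by (simp add: R_tilde_eq_Wr) (intro transpose_Wr symmetric_lq_shift[OF sym] K, auto)
  moreover have "transpose (matrix_inv (R_tilde D k (Q_bar N \<beta> D (Suc k)))) = matrix_inv (R_tilde D k (Q_bar N \<beta> D (Suc k)))" if "k < N" for k
    using that by (simp add: R_tilde_eq_Wr) (intro transpose_matrix_inv transpose_Wr symmetric_lq_shift[OF sym] K W, auto)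
  ultimately show ?thesis
    by (auto simp: symmetric_lq_def convexify_def Q_tilde_def transpose_expand matrix_mul_assoc)
qed

section \<open>The Riccati recursion of the convexified problem\<close>

lemma convexify_dynamics [simp]:
  "Am (convexify N \<beta> D) = Am D" "Bm (convexify N \<beta> D) = Bm D"
  "Sm (convexify N \<beta> D) k = S_tilde D k (Q_bar N \<beta> D (Suc k))"
  "Rm (convexify N \<beta> D) k = R_tilde D k (Q_bar N \<beta> D (Suc k))"
  by (simp_all add: convexify_def)

lemma matrix_mul_diff_right: "A ** (B - C) = A ** B - A ** (C :: real^'n^'m)"
  and matrix_mul_diff_left: "(B' - C') ** A' = B' ** A' - (C' :: real^'n^'m) ** A'"
  by (simp_all add: matrix_eq matrix_vector_expand)

text \<open>Convexification adds the quadratic form of \<open>Q_bar\<close> at the successor state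
  to each stage and subtracts that at the current state. Summed from stage \<open>k\<close> on this
  telescopes, so the cost-to-go drops by the form of \<open>Q_bar\<close> at stage \<open>k\<close>,
  while \<open>W\<^sub>k\<close> and \<open>F\<^sub>k\<close> stay the same.\<close>

lemma Kr_convexify:
  assumes "k \<le> N"
  shows "Kr N (convexify N \<beta> D) k = Kr N D k - Q_bar N \<beta> D k"
  using assms
proof (induction k rule: inc_induct)
  case base
  then show ?case by (simp add: Kr_final Q_bar_final convexify_def)
next
  case (step n)
  have W: "Wr N (convexify N \<beta> D) n = Wr N D n"
    by (simp add: Wr_def step.IH R_tilde_def matrix_mul_diff_right matrix_mul_diff_left)
  have F: "Fr N (convexify N \<beta> D) n = Fr N D n"
    by (simp add: Fr_def step.IH S_tilde_def matrix_mul_diff_right matrix_mul_diff_left)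
  \<comment> \<open>Writing \<open>Q_tilde\<close> as \<open>Q_hat\<close> minus
    \<open>Q_bar\<close> keeps its inverse folded; only the telescoping terms remain.\<close>
  have Q: "Q_bar N \<beta> D n = Q_hat D n (Q_bar N \<beta> D (Suc n)) - Qm (convexify N \<beta> D) n"
    using step.hyps by (subst Q_bar.simps) (simp add: convexify_def)
  show ?case
    using step.hyps
    by (simp add: Kr_step W F Q step.IH Q_hat_def matrix_mul_diff_right matrix_mul_diff_left)
qed

lemma Wr_convexify: "k < N \<Longrightarrow> Wr N (convexify N \<beta> D) k = Wr N D k"
  by (simp add: Wr_def Kr_convexify R_tilde_def matrix_mul_diff_right matrix_mul_diff_left)


subsection \<open>Stationarity of the Lagrangian\<close>

text \<open>The vector \<open>c\<close> collects the cross terms with other variables. It gets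
  coefficient 1 here; the mirrored terms elsewhere in the cost supply the second half of the factor
  2.\<close>

lemma has_derivative_quadratic:
  fixes M :: "real^'n^'n"
  assumes f: "(f has_derivative f') (at a)" and M: "transpose M = M"
  shows "((\<lambda>v. f v \<bullet> (M *v f v + c)) has_derivative (\<lambda>h. f' h \<bullet> (2 *\<^sub>R (M *v f a) + c))) (at a)"
proof -
  have "((\<lambda>v. M *v f v + c) has_derivative (\<lambda>h. M *v f' h + 0)) (at a)"
    by (intro has_derivative_add has_derivative_const
        bounded_linear.has_derivative[OF matrix_vector_mul_bounded_linear f])
  from has_derivative_inner[OF f this] show ?thesis
    by (rule has_derivative_eq_rhs)
      (use inner_transpose[of "f a" M] M in
        \<open>auto simp: inner_add_right inner_commute[of "M *v f a"]\<close>)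
qed

lemma has_derivative_inner_matrix:
  fixes M :: "real^'n^'m"
  assumes f: "(f has_derivative f') (at a)"
  shows "((\<lambda>v. b \<bullet> (M *v f v)) has_derivative (\<lambda>h. f' h \<bullet> (transpose M *v b))) (at a)"
  using has_derivative_inner_right[OF bounded_linear.has_derivative[OF matrix_vector_mul_bounded_linear f], of b M]
  by (simp add: inner_transpose inner_commute)

text \<open>An arbitrary differentiable family \<open>F v\<close> of state sequences replaces the
  update at a single stage, so that first, inner and last stages need no separate
  computations.\<close>

lemma lqp_lagrangian_has_derivative_state:
  fixes D :: "('x::finite, 'u::finite, 'd::finite) lq"
  assumes sym: "symmetric_lq N D"
    and F: "\<And>j. ((\<lambda>v. F v j) has_derivative dF j) (at a)"
  shows "((\<lambda>v. lqp_lagrangian N D linit l (F v) q \<zeta>) has_derivative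
    (\<lambda>h. (\<Sum>j<N. dF j h \<bullet> (2 *\<^sub>R (Qm D j *v F a j + transpose (Sm D j) *v q j + transpose (D1m D j) *v l j)
                         + \<zeta> j - transpose (Am D j) *v \<zeta> (Suc j)))
       + dF N h \<bullet> (2 *\<^sub>R (Qm D N *v F a N + transpose (D1m D N) *v l N) + \<zeta> N))) (at a)"
proof -
  have stage: "((\<lambda>v. F v j \<bullet> (Qm D j *v F v j + transpose (Sm D j) *v q j + transpose (D1m D j) *v l j) +
      q j \<bullet> (Sm D j *v F v j + Rm D j *v q j + transpose (D2m D j) *v l j) +
      l j \<bullet> (D1m D j *v F v j + D2m D j *v q j)) has_derivative
     (\<lambda>h. dF j h \<bullet> (2 *\<^sub>R (Qm D j *v F a j + transpose (Sm D j) *v q j + transpose (D1m D j) *v l j)))) (at a)"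
    if "j < N" for j
  proof -
    have "transpose (Qm D j) = Qm D j" using sym that by (simp add: symmetric_lq_def)
    \<comment> \<open>The stage cost is regrouped into a quadratic part, linear parts and a
      constant; each cross term occurs once with \<open>F v j\<close> on either side.\<close>
    then have "((\<lambda>v. F v j \<bullet> (Qm D j *v F v j + (transpose (Sm D j) *v q j + transpose (D1m D j) *v l j)) +
        q j \<bullet> (Sm D j *v F v j) + l j \<bullet> (D1m D j *v F v j) +
        (q j \<bullet> (Rm D j *v q j + transpose (D2m D j) *v l j) + l j \<bullet> (D2m D j *v q j))) has_derivative
       (\<lambda>h. dF j h \<bullet> (2 *\<^sub>R (Qm D j *v F a j) + (transpose (Sm D j) *v q j + transpose (D1m D j) *v l j)) +
         dF j h \<bullet> (transpose (Sm D j) *v q j) + dF j h \<bullet> (transpose (D1m D j) *v l j) + 0)) (at a)"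
      by (intro has_derivative_add has_derivative_quadratic has_derivative_inner_matrix has_derivative_const F)
    then show ?thesis
      by (simp add: inner_add_right add_ac)
  qed
  have final: "((\<lambda>v. F v N \<bullet> (Qm D N *v F v N + transpose (D1m D N) *v l N) + l N \<bullet> (D1m D N *v F v N)) has_derivative
     (\<lambda>h. dF N h \<bullet> (2 *\<^sub>R (Qm D N *v F a N + transpose (D1m D N) *v l N)))) (at a)"
  proof -
    have "transpose (Qm D N) = Qm D N" using sym by (simp add: symmetric_lq_def)
    then have "((\<lambda>v. F v N \<bullet> (Qm D N *v F v N + transpose (D1m D N) *v l N) + l N \<bullet> (D1m D N *v F v N)) has_derivative
       (\<lambda>h. dF N h \<bullet> (2 *\<^sub>R (Qm D N *v F a N) + transpose (D1m D N) *v l N) + dF N h \<bullet> (transpose (D1m D N) *v l N))) (at a)"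
      by (intro has_derivative_add has_derivative_quadratic has_derivative_inner_matrix F)
    then show ?thesis
      by (simp add: inner_add_right add_ac)
  qed
  have constr: "((\<lambda>v. \<zeta> (Suc j) \<bullet> (F v (Suc j) - Am D j *v F v j - Bm D j *v q j - Cm D j *v l j)) has_derivative
     (\<lambda>h. \<zeta> (Suc j) \<bullet> dF (Suc j) h - dF j h \<bullet> (transpose (Am D j) *v \<zeta> (Suc j)))) (at a)" for j
  proof -
    have "((\<lambda>v. \<zeta> (Suc j) \<bullet> F v (Suc j) - \<zeta> (Suc j) \<bullet> (Am D j *v F v j)
          - \<zeta> (Suc j) \<bullet> (Bm D j *v q j + Cm D j *v l j)) has_derivative
       (\<lambda>h. \<zeta> (Suc j) \<bullet> dF (Suc j) h - dF j h \<bullet> (transpose (Am D j) *v \<zeta> (Suc j)) - 0)) (at a)"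
      by (intro has_derivative_diff has_derivative_inner_matrix has_derivative_inner_right has_derivative_const F)
    then show ?thesis
      by (simp add: inner_add_right inner_diff_right diff_diff_eq add_ac)
  qed
  have init: "((\<lambda>v. \<zeta> 0 \<bullet> (F v 0 - linit)) has_derivative (\<lambda>h. \<zeta> 0 \<bullet> dF 0 h)) (at a)"
    using has_derivative_inner_right[OF has_derivative_diff[OF F[of 0] has_derivative_const[of linit]], of "\<zeta> 0"]
    by simp
  \<comment> \<open>Re-indexing pairs \<open>dF j\<close> with \<open>\<zeta> j\<close>, the
    multiplier of the equation that determines state \<open>j\<close>; the initial condition fills
    the slot 0.\<close>
  have tele: "(\<Sum>j<N. \<zeta> (Suc j) \<bullet> dF (Suc j) h) + \<zeta> 0 \<bullet> dF 0 h = (\<Sum>j<N. \<zeta> j \<bullet> dF j h) + \<zeta> N \<bullet> dF N h" for h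
    using sum.lessThan_Suc_shift[of "\<lambda>j. \<zeta> j \<bullet> dF j h" N] by simp
  show ?thesis
    unfolding lqp_lagrangian_def lqp_cost_def
  proof (rule has_derivative_eq_rhs)
    show "((\<lambda>v. (\<Sum>j<N. F v j \<bullet> (Qm D j *v F v j + transpose (Sm D j) *v q j + transpose (D1m D j) *v l j) +
        q j \<bullet> (Sm D j *v F v j + Rm D j *v q j + transpose (D2m D j) *v l j) +
        l j \<bullet> (D1m D j *v F v j + D2m D j *v q j)) +
        (F v N \<bullet> (Qm D N *v F v N + transpose (D1m D N) *v l N) + l N \<bullet> (D1m D N *v F v N)) +
        (\<Sum>j<N. \<zeta> (Suc j) \<bullet> (F v (Suc j) - Am D j *v F v j - Bm D j *v q j - Cm D j *v l j)) +
        \<zeta> 0 \<bullet> (F v 0 - linit)) has_derivative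
      (\<lambda>h. (\<Sum>j<N. dF j h \<bullet> (2 *\<^sub>R (Qm D j *v F a j + transpose (Sm D j) *v q j + transpose (D1m D j) *v l j))) +
        dF N h \<bullet> (2 *\<^sub>R (Qm D N *v F a N + transpose (D1m D N) *v l N)) +
        (\<Sum>j<N. \<zeta> (Suc j) \<bullet> dF (Suc j) h - dF j h \<bullet> (transpose (Am D j) *v \<zeta> (Suc j))) +
        \<zeta> 0 \<bullet> dF 0 h)) (at a)"
      by (intro has_derivative_add has_derivative_sum stage final constr init) auto
  qed (use tele in \<open>auto simp: fun_eq_iff inner_add_right inner_diff_right sum.distrib sum_subtractf
      inner_commute[of "\<zeta> _"]\<close>)
qed

text \<open>The same scheme for controls, which meet the multipliers only through \<open>Bm\<close>
  at their own stage, so that no re-indexing arises.\<close>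

lemma lqp_lagrangian_has_derivative_control:
  fixes D :: "('x::finite, 'u::finite, 'd::finite) lq"
  assumes sym: "symmetric_lq N D"
    and F: "\<And>j. ((\<lambda>v. F v j) has_derivative dF j) (at a)"
  shows "((\<lambda>v. lqp_lagrangian N D linit l p (F v) \<zeta>) has_derivative
    (\<lambda>h. \<Sum>j<N. dF j h \<bullet> (2 *\<^sub>R (Sm D j *v p j + Rm D j *v F a j + transpose (D2m D j) *v l j)
                         - transpose (Bm D j) *v \<zeta> (Suc j)))) (at a)"
proof -
  have stage: "((\<lambda>v. p j \<bullet> (Qm D j *v p j + transpose (Sm D j) *v F v j + transpose (D1m D j) *v l j) +
      F v j \<bullet> (Sm D j *v p j + Rm D j *v F v j + transpose (D2m D j) *v l j) +
      l j \<bullet> (D1m D j *v p j + D2m D j *v F v j)) has_derivative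
     (\<lambda>h. dF j h \<bullet> (2 *\<^sub>R (Sm D j *v p j + Rm D j *v F a j + transpose (D2m D j) *v l j)))) (at a)"
    if "j < N" for j
  proof -
    have "transpose (Rm D j) = Rm D j" using sym that by (simp add: symmetric_lq_def)
    then have "((\<lambda>v. F v j \<bullet> (Rm D j *v F v j + (Sm D j *v p j + transpose (D2m D j) *v l j)) +
        p j \<bullet> (transpose (Sm D j) *v F v j) + l j \<bullet> (D2m D j *v F v j) +
        (p j \<bullet> (Qm D j *v p j + transpose (D1m D j) *v l j) + l j \<bullet> (D1m D j *v p j))) has_derivative
       (\<lambda>h. dF j h \<bullet> (2 *\<^sub>R (Rm D j *v F a j) + (Sm D j *v p j + transpose (D2m D j) *v l j)) +
         dF j h \<bullet> (transpose (transpose (Sm D j)) *v p j) + dF j h \<bullet> (transpose (D2m D j) *v l j) + 0)) (at a)"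
      by (intro has_derivative_add has_derivative_quadratic has_derivative_inner_matrix has_derivative_const F)
    then show ?thesis
      by (simp add: inner_add_right add_ac)
  qed
  have constr: "((\<lambda>v. \<zeta> (Suc j) \<bullet> (p (Suc j) - Am D j *v p j - Bm D j *v F v j - Cm D j *v l j)) has_derivative
     (\<lambda>h. - (dF j h \<bullet> (transpose (Bm D j) *v \<zeta> (Suc j))))) (at a)" for j
  proof -
    have "((\<lambda>v. \<zeta> (Suc j) \<bullet> (p (Suc j) - Am D j *v p j - Cm D j *v l j)
          - \<zeta> (Suc j) \<bullet> (Bm D j *v F v j)) has_derivative
       (\<lambda>h. 0 - dF j h \<bullet> (transpose (Bm D j) *v \<zeta> (Suc j)))) (at a)"
      by (intro has_derivative_diff has_derivative_inner_matrix has_derivative_const F)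
    then show ?thesis
      by (simp add: inner_diff_right algebra_simps)
  qed
  show ?thesis
    unfolding lqp_lagrangian_def lqp_cost_def
  proof (rule has_derivative_eq_rhs)
    show "((\<lambda>v. (\<Sum>j<N. p j \<bullet> (Qm D j *v p j + transpose (Sm D j) *v F v j + transpose (D1m D j) *v l j) +
        F v j \<bullet> (Sm D j *v p j + Rm D j *v F v j + transpose (D2m D j) *v l j) +
        l j \<bullet> (D1m D j *v p j + D2m D j *v F v j)) +
        (p N \<bullet> (Qm D N *v p N + transpose (D1m D N) *v l N) + l N \<bullet> (D1m D N *v p N)) +
        (\<Sum>j<N. \<zeta> (Suc j) \<bullet> (p (Suc j) - Am D j *v p j - Bm D j *v F v j - Cm D j *v l j)) +
        \<zeta> 0 \<bullet> (p 0 - linit)) has_derivative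
      (\<lambda>h. (\<Sum>j<N. dF j h \<bullet> (2 *\<^sub>R (Sm D j *v p j + Rm D j *v F a j + transpose (D2m D j) *v l j))) +
        0 + (\<Sum>j<N. - (dF j h \<bullet> (transpose (Bm D j) *v \<zeta> (Suc j)))) + 0)) (at a)"
      by (intro has_derivative_add has_derivative_sum stage constr has_derivative_const) auto
  qed (auto simp: fun_eq_iff inner_diff_right sum_subtractf sum_negf)
qed

text \<open>By uniqueness of derivatives the computed partial derivatives vanish in every direction
  \<open>h\<close>; taking \<open>h\<close> to be the gradient itself leaves its squared
  norm.\<close>

lemma lqp_dual_stationarity:
  fixes D :: "('x::finite, 'u::finite, 'd::finite) lq"
  assumes sym: "symmetric_lq N D" and dual: "lqp_dual_solution N D linit l p q \<zeta>"
  shows "\<zeta> N = - 2 *\<^sub>R (Qm D N *v p N + transpose (D1m D N) *v l N)"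
    and "k < N \<Longrightarrow> \<zeta> k = transpose (Am D k) *v \<zeta> (Suc k)
      - 2 *\<^sub>R (Qm D k *v p k + transpose (Sm D k) *v q k + transpose (D1m D k) *v l k)"
    and "k < N \<Longrightarrow> transpose (Bm D k) *v \<zeta> (Suc k)
      = 2 *\<^sub>R (Sm D k *v p k + Rm D k *v q k + transpose (D2m D k) *v l k)"
proof -
  have upd: "((\<lambda>v. (f(k := v)) j) has_derivative (\<lambda>h. if j = k then h else 0)) (at a)"
    for f :: "nat \<Rightarrow> 'z::real_normed_vector" and k j a
    by (cases "j = k") auto
  let ?X = "\<lambda>j. 2 *\<^sub>R (Qm D j *v p j + transpose (Sm D j) *v q j + transpose (D1m D j) *v l j)
                 + \<zeta> j - transpose (Am D j) *v \<zeta> (Suc j)"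
    and ?XN = "2 *\<^sub>R (Qm D N *v p N + transpose (D1m D N) *v l N) + \<zeta> N"
    and ?Y = "\<lambda>j. 2 *\<^sub>R (Sm D j *v p j + Rm D j *v q j + transpose (D2m D j) *v l j)
                 - transpose (Bm D j) *v \<zeta> (Suc j)"
  have x: "(\<Sum>j<N. (if j = k then h else 0) \<bullet> ?X j) + (if N = k then h else 0) \<bullet> ?XN = 0" if "k \<le> N" for k h
  proof -
    have "((\<lambda>v. lqp_lagrangian N D linit l (p(k := v)) q \<zeta>) has_derivative (\<lambda>_. 0)) (at (p k))"
      using dual that unfolding lqp_dual_solution_def by blast
    from fun_cong[OF has_derivative_unique[OF lqp_lagrangian_has_derivative_state[OF sym upd] this], of h]
    show ?thesis by (simp only: fun_upd_triv)
  qed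
  have "h \<bullet> ?XN = 0" for h using x[of N h] by simp
  from this[of ?XN] have "?XN = 0" by (simp only: inner_eq_zero_iff)
  then show "\<zeta> N = - 2 *\<^sub>R (Qm D N *v p N + transpose (D1m D N) *v l N)"
    by (simp add: add_eq_0_iff2)
  assume k: "k < N"
  have "h \<bullet> ?X k = 0" for h
    using x[of k h] k by (simp add: if_distrib[of "\<lambda>t. t \<bullet> _"] cong: if_cong)
  from this[of "?X k"] have "?X k = 0" by (simp only: inner_eq_zero_iff)
  then show "\<zeta> k = transpose (Am D k) *v \<zeta> (Suc k)
      - 2 *\<^sub>R (Qm D k *v p k + transpose (Sm D k) *v q k + transpose (D1m D k) *v l k)"
    by (simp add: eq_diff_eq add.commute)
  have "((\<lambda>v. lqp_lagrangian N D linit l p (q(k := v)) \<zeta>) has_derivative (\<lambda>_. 0)) (at (q k))"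
    using dual k unfolding lqp_dual_solution_def by blast
  from fun_cong[OF has_derivative_unique[OF lqp_lagrangian_has_derivative_control[OF sym upd] this]]
  have "(\<Sum>j<N. (if j = k then h else 0) \<bullet> ?Y j) = 0" for h
    by (simp only: fun_upd_triv)
  then have "h \<bullet> ?Y k = 0" for h
    using k by (simp add: if_distrib[of "\<lambda>t. t \<bullet> _"] cong: if_cong)
  from this[of "?Y k"] have "?Y k = 0" by (simp only: inner_eq_zero_iff)
  then show "transpose (Bm D k) *v \<zeta> (Suc k)
      = 2 *\<^sub>R (Sm D k *v p k + Rm D k *v q k + transpose (D2m D k) *v l k)"
    by simp
qed

subsection \<open>The multiplier formula\<close>

lemma Eprod_self [simp]: "Eprod N D k k = mat 1"
  by (cases k) auto

text \<open>\<open>Eprod\<close> recurses on the latest factor, whereas the backward recursion of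
  the multipliers has to split off the earliest one.\<close>

lemma Eprod_first: "k < n \<Longrightarrow> Eprod N D k n = Eprod N D (Suc k) n ** Er N D k"
proof (induction n)
  case (Suc n)
  then show ?case by (cases "k = n") (auto simp: matrix_mul_assoc)
qed simp

lemma Vr_Mr_first:
  "k < i \<Longrightarrow> Vr N D i k = Vr N D i (Suc k) ** Er N D k"
  "k < i \<Longrightarrow> Mr N D i k = Mr N D i (Suc k) ** Er N D k"
  by (simp_all add: Vr_def Mr_def Eprod_first[of k] matrix_mul_assoc matrix_eq matrix_vector_expand
      del: Eprod.simps)

text \<open>The vector \<open>s\<^sub>j\<close> of the ansatz for \<open>\<zeta>\<close>: half of
  the part of the multiplier that comes from \<open>l\<close> directly rather than through the
  state.\<close>

definition costate_offset ::
  "nat \<Rightarrow> ('x::finite, 'u::finite, 'd::finite) lq \<Rightarrow> (nat \<Rightarrow> real^'d) \<Rightarrow> nat \<Rightarrow> real^'x" where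
  "costate_offset N D l j =
    (\<Sum>i=j..N. transpose (Mr N D i j) *v l i) + (\<Sum>i=j..<N. transpose (Vr N D i j) *v (Cm D i *v l i))"

lemma costate_offset_final: "costate_offset N D l N = - (transpose (D1m D N) *v l N)"
  by (simp add: costate_offset_def Mr_def transpose_minus minus_matrix_vector_mult)

lemma matrix_vector_sum: "A *v (\<Sum>i\<in>I. f i) = (\<Sum>i\<in>I. A *v (f i :: real^'n))"
  by (rule linear_sum) simp

text \<open>The sums solve a backward linear recursion with matrix \<open>E\<^sub>k\<^sup>T\<close>:
  the summands with \<open>i = k\<close> form the inhomogeneity, and all later ones share the factor
  \<open>E\<^sub>k\<^sup>T\<close>.\<close>

lemma costate_offset_step:
  assumes k: "k < N"
  shows "costate_offset N D l k =
    - (transpose (D1m D k) *v l k + transpose (Pr N D k) *v (transpose (D2m D k) *v l k))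
    - transpose (Er N D k) *v (transpose (Kr N D (Suc k)) *v (Cm D k *v l k))
    + transpose (Er N D k) *v costate_offset N D l (Suc k)"
proof -
  have "(\<Sum>i=k..N. transpose (Mr N D i k) *v l i)
      = transpose (Mr N D k k) *v l k + (\<Sum>i=Suc k..N. transpose (Mr N D i k) *v l i)"
    using k by (simp add: sum.atLeast_Suc_atMost)
  moreover have "(\<Sum>i=Suc k..N. transpose (Mr N D i k) *v l i)
      = transpose (Er N D k) *v (\<Sum>i=Suc k..N. transpose (Mr N D i (Suc k)) *v l i)"
    unfolding matrix_vector_sum
    by (intro sum.cong) (simp_all add: Vr_Mr_first matrix_transpose_mul matrix_vector_mul_assoc[symmetric])
  moreover have "(\<Sum>i=k..<N. transpose (Vr N D i k) *v (Cm D i *v l i))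
      = transpose (Vr N D k k) *v (Cm D k *v l k) + (\<Sum>i=Suc k..<N. transpose (Vr N D i k) *v (Cm D i *v l i))"
    using k by (simp add: sum.atLeast_Suc_lessThan)
  moreover have "(\<Sum>i=Suc k..<N. transpose (Vr N D i k) *v (Cm D i *v l i))
      = transpose (Er N D k) *v (\<Sum>i=Suc k..<N. transpose (Vr N D i (Suc k)) *v (Cm D i *v l i))"
    unfolding matrix_vector_sum
    by (intro sum.cong) (simp_all add: Vr_Mr_first matrix_transpose_mul matrix_vector_mul_assoc[symmetric])
  moreover have "transpose (Mr N D k k) *v l k
      = - (transpose (D1m D k) *v l k + transpose (Pr N D k) *v (transpose (D2m D k) *v l k))"
    using k by (simp add: Mr_def transpose_expand matrix_vector_expand)
  moreover have "transpose (Vr N D k k) *v w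
      = - (transpose (Er N D k) *v (transpose (Kr N D (Suc k)) *v w))" for w
    by (simp add: Vr_def transpose_expand matrix_vector_expand)
  ultimately show ?thesis
    unfolding costate_offset_def matrix_vector_right_distrib by simp
qed

text \<open>Stationarity in the control determines \<open>q\<close> as feedback plus an affine
  correction. Inserted into the recursion for the multiplier, it completes the Riccati step in
  \<open>p\<close> and turns \<open>A\<^sub>k\<^sup>T\<close> into \<open>E\<^sub>k\<^sup>T\<close>
  in the affine part.\<close>

lemma costate_step:
  fixes D :: "('x::finite, 'u::finite, 'd::finite) lq"
  assumes sym: "symmetric_lq N D" and k: "k < N" and W: "invertible (Wr N D k)"
    and K: "transpose (Kr N D (Suc k)) = Kr N D (Suc k)"
    and z': "z' = - 2 *\<^sub>R (Kr N D (Suc k) *v (Am D k *v p + Bm D k *v q + Cm D k *v l)) + 2 *\<^sub>R s'"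
    and z: "z = transpose (Am D k) *v z'
      - 2 *\<^sub>R (Qm D k *v p + transpose (Sm D k) *v q + transpose (D1m D k) *v l)"
    and opt: "transpose (Bm D k) *v z' = 2 *\<^sub>R (Sm D k *v p + Rm D k *v q + transpose (D2m D k) *v l)"
    and s: "s = - (transpose (D1m D k) *v l + transpose (Pr N D k) *v (transpose (D2m D k) *v l))
      - transpose (Er N D k) *v (Kr N D (Suc k) *v (Cm D k *v l)) + transpose (Er N D k) *v s'"
  shows "z = - 2 *\<^sub>R (Kr N D k *v p) + 2 *\<^sub>R s"
proof -
  let ?K = "Kr N D (Suc k)" and ?W = "Wr N D k" and ?F = "Fr N D k" and ?A = "Am D k" and ?B = "Bm D k"
  let ?c = "Cm D k *v l"
  \<comment> \<open>The part of the control stationarity condition that involves neither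
    \<open>p\<close> nor \<open>q\<close>.\<close>
  define g where "g = transpose (D2m D k) *v l + transpose ?B *v (?K *v ?c) - transpose ?B *v s'"
  have half: "2 *\<^sub>R a = 2 *\<^sub>R b \<longleftrightarrow> a = b" for a b :: "real^'u" by simp
  have "2 *\<^sub>R (transpose ?B *v (- (?K *v (?A *v p + ?B *v q + ?c)) + s')) =
      2 *\<^sub>R (Sm D k *v p + Rm D k *v q + transpose (D2m D k) *v l)"
    using opt unfolding z'
    by (simp add: matrix_vector_expand scaleR_add_right scaleR_diff_right)
  then have "?W *v q = - (?F *v p) - g"
    unfolding half
    by (simp add: Wr_def Fr_def g_def matrix_vector_expand algebra_simps)
  then have "q = matrix_inv ?W *v (- (?F *v p) - g)"
    by (metis W matrix_inv_left matrix_vector_mul_assoc matrix_vector_mul_lid)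
  then have q: "q = Pr N D k *v p - matrix_inv ?W *v g"
    by (simp add: Pr_Fr matrix_vector_expand)
  have "transpose (matrix_inv ?W) = matrix_inv ?W"
    by (intro transpose_matrix_inv W transpose_Wr sym k K)
  \<comment> \<open>Symmetry of the inverse turns the correction
    \<open>- F\<^sub>k\<^sup>T W\<^sub>k\<^sup>-\<^sup>1 g\<close> into
    \<open>P\<^sub>k\<^sup>T g\<close>, the form in which it enters \<open>s\<close>.\<close>
  then have Pg: "transpose (Pr N D k) *v g = - (transpose ?F *v (matrix_inv ?W *v g))"
    by (simp add: Pr_Fr transpose_expand matrix_vector_expand)
  have "transpose ?F *v q = transpose ?F *v (Pr N D k *v p) + transpose (Pr N D k) *v g"
    unfolding Pg by (subst q) (simp add: matrix_vector_expand)
  moreover have "transpose ?F *v q = transpose ?A *v (?K *v (?B *v q)) + transpose (Sm D k) *v q"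
    by (simp add: Fr_def transpose_expand matrix_vector_expand K matrix_mul_assoc[symmetric])
  \<comment> \<open>Two evaluations of \<open>F\<^sub>k\<^sup>T q\<close> give
    \<open>S\<^sub>k\<^sup>T q\<close>; its last term cancels the \<open>q\<close> that
    \<open>z'\<close> brings in through the dynamics.\<close>
  ultimately have Fq: "transpose (Sm D k) *v q =
      transpose ?F *v (Pr N D k *v p) + transpose (Pr N D k) *v g - transpose ?A *v (?K *v (?B *v q))"
    by (simp add: eq_diff_eq add.commute)
  have "z = 2 *\<^sub>R (transpose ?A *v (- (?K *v (?A *v p + ?B *v q + ?c)) + s')
      - (Qm D k *v p + transpose (Sm D k) *v q + transpose (D1m D k) *v l))"
    unfolding z z'
    by (simp add: matrix_vector_expand scaleR_add_right scaleR_diff_right)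
  also have "\<dots> = 2 *\<^sub>R (- (Kr N D k *v p) + s)"
    unfolding Fq s Kr_step_Pr[OF k] g_def
    by (simp add: Er_def transpose_expand matrix_vector_expand algebra_simps)
  finally show ?thesis by (simp add: scaleR_diff_right)
qed

text \<open>Backward induction from the final stationarity condition. Stated for any symmetric
  problem with invertible \<open>W\<^sub>k\<close>, it covers the original and the convexified
  problem at once.\<close>

lemma lqp_dual_solution_formula:
  fixes D :: "('x::finite, 'u::finite, 'd::finite) lq"
  assumes sym: "symmetric_lq N D" and W: "\<And>k. k < N \<Longrightarrow> invertible (Wr N D k)"
    and feas: "lqp_feasible N D linit l p q" and dual: "lqp_dual_solution N D linit l p q \<zeta>"
    and j: "j \<le> N"
  shows "\<zeta> j = - 2 *\<^sub>R (Kr N D j *v p j)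
    + 2 *\<^sub>R (\<Sum>i=j..N. transpose (Mr N D i j) *v l i)
    + 2 *\<^sub>R (\<Sum>i=j..<N. transpose (Vr N D i j) *v (Cm D i *v l i))"
proof -
  note stat = lqp_dual_stationarity[OF sym dual]
  have "\<zeta> j = - 2 *\<^sub>R (Kr N D j *v p j) + 2 *\<^sub>R costate_offset N D l j"
    using j
  proof (induction j rule: inc_induct)
    case base
    show ?case
      unfolding stat(1) Kr_final costate_offset_final by (simp add: scaleR_add_right)
  next
    case (step k)
    have K: "transpose (Kr N D (Suc k)) = Kr N D (Suc k)"
      using step by (intro transpose_Kr sym W) auto
    have "p (Suc k) = Am D k *v p k + Bm D k *v q k + Cm D k *v l k"
      using feas step.hyps by (simp add: lqp_feasible_def)
    \<comment> \<open>Replacing \<open>p (Suc k)\<close> by the dynamics brings the induction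
      hypothesis into the shape that \<open>costate_step\<close> expects for
      \<open>z'\<close>.\<close>
    note IH = step.IH[unfolded this]
    show ?case
      by (rule costate_step[OF sym step.hyps(2) W[OF step.hyps(2)] K IH stat(2,3)[OF step.hyps(2)]
            costate_offset_step[OF step.hyps(2), of D l, unfolded K]])
  qed
  then show ?thesis
    by (simp add: costate_offset_def scaleR_add_right add.assoc)
qed

section \<open>The formula at the local solution and for its convexification\<close>

theorem theorem4:
  fixes P :: "('x::finite, 'u::finite, 'd::finite) ocp"
    and N m :: nat
    and xbar linit :: "real^'x"
    and d l :: "nat \<Rightarrow> real^'d"
    and x lam :: "nat \<Rightarrow> real^'x"
    and u :: "nat \<Rightarrow> real^'u"
    and D :: "('x, 'u, 'd) lq"
    and Z :: "('x, 'u) coord \<Rightarrow> nat \<Rightarrow> real"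
    and \<gamma> :: real
  assumes "N \<ge> 1"
    and "smooth_ocp N P"
    and "ocp_local_primal_dual_solution N P xbar d x u lam"
    and "D = lq_of_ocp N P d x u lam"
    and "orthonormal_kernel_basis N D m Z"
    and "\<gamma> > 0"
    and "succeq_scaled_id m (reduced_hessian N D Z) \<gamma>"
  shows "(\<forall>p q \<zeta>. lqp_primal_solution N D linit l p q \<longrightarrow> lqp_dual_solution N D linit l p q \<zeta> \<longrightarrow>
            (\<forall>j\<le>N. \<zeta> j =
               - 2 *\<^sub>R (Kr N D j *v p j)
               + 2 *\<^sub>R (\<Sum>i=j..N. transpose (Mr N D i j) *v l i)
               + 2 *\<^sub>R (\<Sum>i=j..<N. transpose (Vr N D i j) *v (Cm D i *v l i))))
       \<and> (\<forall>\<beta> D' p q \<zeta>. 0 < \<beta> \<longrightarrow> \<beta> < \<gamma> \<longrightarrow> D' = convexify N \<beta> D \<longrightarrow>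
            lqp_primal_solution N D' linit l p q \<longrightarrow> lqp_dual_solution N D' linit l p q \<zeta> \<longrightarrow>
            (\<forall>j\<le>N. \<zeta> j =
               - 2 *\<^sub>R (Kr N D' j *v p j)
               + 2 *\<^sub>R (\<Sum>i=j..N. transpose (Mr N D' i j) *v l i)
               + 2 *\<^sub>R (\<Sum>i=j..<N. transpose (Vr N D' i j) *v (Cm D' i *v l i))))"
  proof -
  have sym: "symmetric_lq N D"
    using transpose_Qm_Rm_lq_of_ocp[OF assms(2,4)] by (simp add: symmetric_lq_def)
  have co: "reduced_coercive N D \<gamma>"
    using assms(5,7) by (rule reduced_coercive_of_reduced_hessian)
  have W: "invertible (Wr N D k)" if "k < N" for k
    using sym co assms(6) that by (rule reduced_coercive_invertible_Wr)
  show ?thesis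
  proof (intro conjI allI impI)
    fix p q \<zeta> j
    assume "lqp_primal_solution N D linit l p q" "lqp_dual_solution N D linit l p q \<zeta>" "j \<le> N"
    then show "\<zeta> j = - 2 *\<^sub>R (Kr N D j *v p j)
        + 2 *\<^sub>R (\<Sum>i=j..N. transpose (Mr N D i j) *v l i)
        + 2 *\<^sub>R (\<Sum>i=j..<N. transpose (Vr N D i j) *v (Cm D i *v l i))"
      using lqp_dual_solution_formula[OF sym W] unfolding lqp_primal_solution_def by blast
  next
    fix \<beta> D' p q \<zeta> j
    assume \<beta>: "0 < \<beta>" "\<beta> < \<gamma>" and D': "D' = convexify N \<beta> D"
      and sol: "lqp_primal_solution N D' linit l p q" "lqp_dual_solution N D' linit l p q \<zeta>" "j \<le> N"
    have "symmetric_lq N D'"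
      unfolding D' using sym co \<beta> by (rule symmetric_lq_convexify)
    \<comment> \<open>Invertibility carries over because both problems share the matrices
      \<open>W\<^sub>k\<close>.\<close>
    moreover have "invertible (Wr N D' k)" if "k < N" for k
      using W[OF that] by (simp add: D' Wr_convexify that)
    ultimately show "\<zeta> j = - 2 *\<^sub>R (Kr N D' j *v p j)
        + 2 *\<^sub>R (\<Sum>i=j..N. transpose (Mr N D' i j) *v l i)
        + 2 *\<^sub>R (\<Sum>i=j..<N. transpose (Vr N D' i j) *v (Cm D' i *v l i))"
      using sol lqp_dual_solution_formula[of N D'] unfolding lqp_primal_solution_def by blast
  qed
qed

end
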